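(* Let $k\ge 0$ be an integer and $\underline{s}\in S^{q-1}$. For $(\underline{x},\underline{y})\in\mathbb{R}^p\times\mathbb{R}^q$ the function $$A=\int_{S^{p-1}} (\langle \underline{x},\underline{t}\rangle+i\langle\underline{y},\underline{s}\rangle)^k\,\underline{t}\,dS(\underline{t})$$ is of the form $$A=\lambda_{p-1}\sum_{j=0}^{[\frac{k-1}{2}]} \underline{x}^{2j+1} a_j(\langle\underline{y},\underline{s}\rangle),$$ where $$a_j(\langle\underline{y},\underline{s}\rangle)=(-1)^j \binom{k}{2j+1}\frac{\Gamma(\frac{p-1}{2})\Gamma(j+\frac{3}{2})}{\Gamma(\frac{p}{2}+j+1)}(i\langle\underline{y},\underline{s}\rangle)^{k-2j-1}$$ and $\lambda_{p-1}$ is the measure of the unit sphere $S^{p-1}$ of $\mathbb{R}^p$.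
   Context: $\mathbb{C}_{p+q}$ is the complex Clifford algebra with generators $e_1,\dots,e_{p+q}$ satisfying $e_ie_j+e_je_i=-2\delta_{ij}$. Vectors $\underline{x},\underline{t}\in\mathbb{R}^p$ are embedded as $\sum_{j=1}^p x_je_j$, $\sum_{j=1}^p t_je_j$, and $\underline{y},\underline{s}\in\mathbb{R}^q$ as $\sum_{j=1}^q y_je_{p+j}$, $\sum_{j=1}^q s_je_{p+j}$; powers $\underline{x}^n$ are Clifford powers. $i$ is the (central) imaginary unit, $\langle\cdot,\cdot\rangle$ the Euclidean inner product, $S^{m-1}$ the unit sphere of $\mathbb{R}^m$, $dS$ its scalar surface element, and $\Gamma$ the Gamma function. $[\cdot]$ denotes the integer part (floor), with empty sums equal to $0$.
   Formalization: Here λ_{p-1} is taken as the measure of the unit sphere S^{p-2} of R^{p-1}, with p ≥ 2: with S^{p-1} of R^p the identity fails (p=3, k=1 gives (4π/3)x against (8π/3)x), and for p=1 the factor Γ((p-1)/2) is undefined. *)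

theory Defs
  imports "HOL-Analysis.Analysis"
begin

section \<open>The complex Clifford algebra\<close>

text \<open>
  The generators are indexed by a finite linearly ordered type \<open>'n\<close>. An element is its family of
  complex coefficients with respect to the basis of blades
  \<open>e\<^sub>A = e\<^sub>a\<^sub>1 \<cdots> e\<^sub>a\<^sub>r\<close>, where \<open>A = {a\<^sub>1 < \<dots> < a\<^sub>r}\<close> ranges over the subsets of \<open>'n\<close>.
\<close>

typedef ('n::finite) clifford = "UNIV :: (complex ^ ('n set)) set"
  morphisms ccoeffs Clifford ..

setup_lifting type_definition_clifford

lemma clifford_eqI: "(\<And>A. ccoeffs u $ A = ccoeffs v $ A) \<Longrightarrow> u = v"
  by (simp add: ccoeffs_inject[symmetric] vec_eq_iff)

instantiation clifford :: (finite) real_vector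
begin

lift_definition zero_clifford :: "'a clifford" is 0 .
lift_definition plus_clifford :: "'a clifford \<Rightarrow> 'a clifford \<Rightarrow> 'a clifford" is "(+)" .
lift_definition minus_clifford :: "'a clifford \<Rightarrow> 'a clifford \<Rightarrow> 'a clifford" is "(-)" .
lift_definition uminus_clifford :: "'a clifford \<Rightarrow> 'a clifford" is uminus .
lift_definition scaleR_clifford :: "real \<Rightarrow> 'a clifford \<Rightarrow> 'a clifford" is scaleR .

instance
proof
  fix u v w :: "'a clifford" and r s :: real
  show "u + v + w = u + (v + w)" by transfer (rule add.assoc)
  show "u + v = v + u" by transfer (rule add.commute)
  show "0 + u = u" by transfer simp
  show "- u + u = 0" by transfer simp
  show "u - v = u + - v" by transfer simp
  show "r *\<^sub>R (u + v) = r *\<^sub>R u + r *\<^sub>R v" by transfer (rule scaleR_add_right)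
  show "(r + s) *\<^sub>R u = r *\<^sub>R u + s *\<^sub>R u" by transfer (rule scaleR_add_left)
  show "r *\<^sub>R s *\<^sub>R u = (r * s) *\<^sub>R u" by transfer simp
  show "1 *\<^sub>R u = u" by transfer simp
qed

end

instantiation clifford :: (finite) real_inner
begin

lift_definition inner_clifford :: "'a clifford \<Rightarrow> 'a clifford \<Rightarrow> real" is inner .
lift_definition norm_clifford :: "'a clifford \<Rightarrow> real" is norm .

definition dist_clifford :: "'a clifford \<Rightarrow> 'a clifford \<Rightarrow> real"
  where "dist_clifford u v = norm (u - v)"
definition sgn_clifford :: "'a clifford \<Rightarrow> 'a clifford"
  where "sgn_clifford u = u /\<^sub>R norm u"
definition uniformity_clifford :: "('a clifford \<times> 'a clifford) filter"
  where "uniformity_clifford = (INF e\<in>{0 <..}. principal {(u, v). dist u v < e})"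
definition open_clifford :: "'a clifford set \<Rightarrow> bool"
  where "open_clifford U =
    (\<forall>u\<in>U. eventually (\<lambda>(u', v). u' = u \<longrightarrow> v \<in> U) uniformity)"

instance
proof
  fix u v w :: "'a clifford" and r s :: real and U :: "'a clifford set"
  show "dist u v = norm (u - v)" by (rule dist_clifford_def)
  show "sgn u = u /\<^sub>R norm u" by (rule sgn_clifford_def)
  show "uniformity = (INF e\<in>{0 <..}. principal {(u, v). dist u (v :: 'a clifford) < e})"
    by (rule uniformity_clifford_def)
  show "open U = (\<forall>u\<in>U. eventually (\<lambda>(u', v). u' = u \<longrightarrow> v \<in> U) uniformity)"
    by (rule open_clifford_def)
  show "inner u v = inner v u" by transfer (rule inner_commute)
  show "inner (u + v) w = inner u w + inner v w" by transfer (rule inner_add_left)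
  show "inner (r *\<^sub>R u) v = r * inner u v" by transfer simp
  show "0 \<le> inner u u" by transfer simp
  show "inner u u = 0 \<longleftrightarrow> u = 0" by transfer simp
  show "norm u = sqrt (inner u u)" by transfer (rule norm_eq_sqrt_inner)
qed

end

instantiation clifford :: (finite) euclidean_space
begin

definition Basis_clifford :: "'a clifford set" where "Basis_clifford = Clifford ` Basis"

instance
proof
  show "(Basis :: 'a clifford set) \<noteq> {}" by (simp add: Basis_clifford_def)
  show "finite (Basis :: 'a clifford set)" by (simp add: Basis_clifford_def)
  fix u v :: "'a clifford"
  show "u \<in> Basis \<Longrightarrow> v \<in> Basis \<Longrightarrow> inner u v = (if u = v then 1 else 0)"
    by (auto simp: Basis_clifford_def inner_clifford.rep_eq Clifford_inverse Clifford_inject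
        inner_Basis)
  show "(\<forall>w\<in>Basis. inner u w = 0) \<longleftrightarrow> u = 0"
    by (simp add: Basis_clifford_def inner_clifford.rep_eq Clifford_inverse
        euclidean_all_zero_iff ccoeffs_inject[symmetric] zero_clifford.rep_eq)
qed

end

text \<open>
  \<open>e\<^sub>A e\<^sub>B = blade_sign A B \<cdot> e\<^sub>C\<close> with \<open>C\<close> the symmetric difference: moving each \<open>e\<^sub>b\<close> to its place
  gives one sign for every \<open>a \<in> A\<close> with \<open>b < a\<close>, and \<open>e\<^sub>b e\<^sub>b = -1\<close> gives one more when \<open>b \<in> A\<close>.
\<close>

definition blade_sign :: "'n::{finite,linorder} set \<Rightarrow> 'n set \<Rightarrow> complex"
  where "blade_sign A B = (-1) ^ card {(a, b). a \<in> A \<and> b \<in> B \<and> b \<le> a}"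

lemma blade_sign_prod:
  "blade_sign A B = (\<Prod>a\<in>A. \<Prod>b\<in>B. if b \<le> a then -1 else 1)"
proof -
  have "(\<Prod>a\<in>A. \<Prod>b\<in>B. if b \<le> a then -1 else 1 :: complex)
      = (\<Prod>(a, b)\<in>A \<times> B. if b \<le> a then -1 else 1)"
    by (simp add: prod.cartesian_product)
  also have "\<dots> = (\<Prod>p\<in>A \<times> B. if snd p \<le> fst p then -1 else 1)"
    by (simp add: case_prod_unfold)
  also have "\<dots> = (\<Prod>p\<in>{p \<in> A \<times> B. snd p \<le> fst p}. -1)"
    by (rule prod.inter_filter[symmetric]) simp
  also have "\<dots> = (-1) ^ card {p \<in> A \<times> B. snd p \<le> fst p}"
    by simp
  also have "{p \<in> A \<times> B. snd p \<le> fst p} = {(a, b). a \<in> A \<and> b \<in> B \<and> b \<le> a}"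
    by auto
  finally show ?thesis by (simp add: blade_sign_def)
qed

lemma prod_sym_diff:
  fixes f :: "'n::finite \<Rightarrow> complex"
  assumes "\<And>a. f a * f a = 1"
  shows "prod f (sym_diff A B) = prod f A * prod f B"
proof -
  have 1: "prod f A = prod f (A - B) * prod f (A \<inter> B)" for A B
    by (subst prod.union_disjoint[symmetric]) (auto intro: prod.cong)
  have 2: "prod f (A \<inter> B) * prod f (A \<inter> B) = 1"
    by (simp add: prod.distrib[symmetric] assms)
  have "prod f (sym_diff A B) = prod f (A - B) * prod f (B - A)"
    by (rule prod.union_disjoint) auto
  also have "\<dots> = prod f (A - B) * prod f (B - A) * (prod f (A \<inter> B) * prod f (A \<inter> B))"
    by (simp add: 2)
  also have "\<dots> = prod f A * prod f B"
    using 1[of A B] 1[of B A] by (simp add: Int_commute mult_ac)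
  finally show ?thesis .
qed

lemma blade_sign_sym_diff_left:
  "blade_sign (sym_diff A B) C = blade_sign A C * blade_sign B C"
  unfolding blade_sign_prod
  by (rule prod_sym_diff) (simp add: prod.distrib[symmetric] if_distrib cong: if_cong)

lemma blade_sign_sym_diff_right:
  "blade_sign A (sym_diff B C) = blade_sign A B * blade_sign A C"
proof -
  have "(\<Prod>b\<in>sym_diff B C. if b \<le> a then -1 else 1 :: complex)
      = (\<Prod>b\<in>B. if b \<le> a then -1 else 1) * (\<Prod>b\<in>C. if b \<le> a then -1 else 1)" for a
    by (rule prod_sym_diff) simp
  then show ?thesis
    unfolding blade_sign_prod by (simp add: prod.distrib)
qed

lemma blade_sign_empty [simp]: "blade_sign {} A = 1" "blade_sign A {} = 1"
  by (simp_all add: blade_sign_prod)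

instantiation clifford :: ("{finite,linorder}") ring_1
begin

definition one_clifford :: "'a clifford"
  where "one_clifford = Clifford (\<chi> A. if A = {} then 1 else 0)"

text \<open>The pairs \<open>(A, B)\<close> with symmetric difference \<open>C\<close> are parametrised by \<open>A\<close>.\<close>
definition times_clifford :: "'a clifford \<Rightarrow> 'a clifford \<Rightarrow> 'a clifford"
  where "times_clifford u v = Clifford (\<chi> C. \<Sum>A\<in>UNIV.
    blade_sign A (sym_diff A C) * (ccoeffs u $ A * ccoeffs v $ sym_diff A C))"

lemma ccoeffs_times:
  "ccoeffs (u * v) $ C =
    (\<Sum>A\<in>UNIV. blade_sign A (sym_diff A C) * (ccoeffs u $ A * ccoeffs v $ sym_diff A C))"
  by (simp add: times_clifford_def Clifford_inverse)

lemma ccoeffs_one: "ccoeffs 1 $ A = (if A = {} then 1 else 0)"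
  by (simp add: one_clifford_def Clifford_inverse)

instance
proof
  fix u v w :: "'a clifford"
  have assoc: "sym_diff (sym_diff A B) C = sym_diff A (sym_diff B C)" for A B C :: "'a set"
    by auto
  have cancel: "sym_diff A (sym_diff A B) = B" for A B :: "'a set"
    by auto
  show "u * v * w = u * (v * w)"
  proof (rule clifford_eqI)
    fix D
    let ?g = "\<lambda>A B. blade_sign A B * blade_sign (sym_diff A B) (sym_diff (sym_diff A B) D)
      * (ccoeffs u $ A * ccoeffs v $ B * ccoeffs w $ sym_diff (sym_diff A B) D)"
    have "ccoeffs (u * v * w) $ D = (\<Sum>C\<in>UNIV. \<Sum>A\<in>UNIV.
        blade_sign C (sym_diff C D) * (blade_sign A (sym_diff A C)
          * (ccoeffs u $ A * ccoeffs v $ sym_diff A C) * ccoeffs w $ sym_diff C D))"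
      by (simp only: ccoeffs_times sum_distrib_left sum_distrib_right)
    also have "\<dots> = (\<Sum>A\<in>UNIV. \<Sum>C\<in>UNIV.
        blade_sign C (sym_diff C D) * (blade_sign A (sym_diff A C)
          * (ccoeffs u $ A * ccoeffs v $ sym_diff A C) * ccoeffs w $ sym_diff C D))"
      by (rule sum.swap)
    also have "\<dots> = (\<Sum>A\<in>UNIV. \<Sum>B\<in>UNIV. ?g A B)"
    proof (rule sum.cong[OF refl])
      fix A :: "'a set"
      show "(\<Sum>C\<in>UNIV. blade_sign C (sym_diff C D) * (blade_sign A (sym_diff A C)
          * (ccoeffs u $ A * ccoeffs v $ sym_diff A C) * ccoeffs w $ sym_diff C D))
        = (\<Sum>B\<in>UNIV. ?g A B)"
        by (rule sum.reindex_bij_witness[of _ "sym_diff A" "sym_diff A"])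
          (simp_all only: cancel mult_ac UNIV_I)
    qed
    also have "\<dots> = (\<Sum>A\<in>UNIV. \<Sum>B\<in>UNIV. blade_sign A (sym_diff A D) * (ccoeffs u $ A *
        (blade_sign B (sym_diff B (sym_diff A D))
          * (ccoeffs v $ B * ccoeffs w $ sym_diff B (sym_diff A D)))))"
    proof (intro sum.cong refl)
      fix A B :: "'a set"
      let ?E = "sym_diff B (sym_diff A D)"
      have 1: "sym_diff (sym_diff A B) D = ?E" by auto
      have "blade_sign A (sym_diff A D) = blade_sign A (sym_diff B ?E)"
        by (simp only: cancel)
      then have 2: "blade_sign A (sym_diff A D) = blade_sign A B * blade_sign A ?E"
        by (simp only: blade_sign_sym_diff_right[of A B ?E])
      show "?g A B = blade_sign A (sym_diff A D) * (ccoeffs u $ A *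
        (blade_sign B ?E * (ccoeffs v $ B * ccoeffs w $ ?E)))"
        by (simp only: 1 2 blade_sign_sym_diff_left[of A B ?E] mult_ac)
    qed
    also have "\<dots> = ccoeffs (u * (v * w)) $ D"
      by (simp only: ccoeffs_times sum_distrib_left sum_distrib_right)
    finally show "ccoeffs (u * v * w) $ D = ccoeffs (u * (v * w)) $ D" .
  qed
  show "1 * u = u"
    by (rule clifford_eqI)
      (simp add: ccoeffs_times ccoeffs_one if_distrib if_distribR sum.delta cong: if_cong)
  show "u * 1 = u"
  proof (rule clifford_eqI)
    fix C :: "'a set"
    have eq: "sym_diff A C = {} \<longleftrightarrow> A = C" for A by auto
    show "ccoeffs (u * 1) $ C = ccoeffs u $ C"
      by (simp only: ccoeffs_times ccoeffs_one eq)
        (simp add: if_distrib if_distribR sum.delta cong: if_cong)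
  qed
  show "(u + v) * w = u * w + v * w"
    by (rule clifford_eqI)
      (simp add: ccoeffs_times plus_clifford.rep_eq ring_distribs sum.distrib)
  show "u * (v + w) = u * v + u * w"
    by (rule clifford_eqI)
      (simp add: ccoeffs_times plus_clifford.rep_eq ring_distribs sum.distrib)
  have "ccoeffs (0 :: 'a clifford) $ {} \<noteq> ccoeffs 1 $ {}"
    by (simp add: ccoeffs_one zero_clifford.rep_eq)
  then show "(0 :: 'a clifford) \<noteq> 1" by metis
qed

end

instance clifford :: ("{finite,linorder}") real_algebra_1
  by standard
    (rule clifford_eqI,
      simp add: ccoeffs_times scaleR_clifford.rep_eq scaleR_sum_right algebra_simps)+

definition blade :: "'n::finite set \<Rightarrow> 'n clifford"
  where "blade A = Clifford (\<chi> B. if B = A then 1 else 0)"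

definition cgen :: "'n::finite \<Rightarrow> 'n clifford"
  where "cgen i = blade {i}"

text \<open>The complex scalars, as the multiples of the unit.\<close>
definition cscalar :: "complex \<Rightarrow> 'n::finite clifford"
  where "cscalar z = Clifford (\<chi> A. if A = {} then z else 0)"

lemma ccoeffs_blade: "ccoeffs (blade A) $ B = (if B = A then 1 else 0)"
  by (simp add: blade_def Clifford_inverse)

lemma ccoeffs_cscalar: "ccoeffs (cscalar z) $ A = (if A = {} then z else 0)"
  by (simp add: cscalar_def Clifford_inverse)

lemma ccoeffs_cscalar_times: "ccoeffs (cscalar z * u) $ A = z * ccoeffs u $ A"
  by (simp add: ccoeffs_times ccoeffs_cscalar if_distrib if_distribR sum.delta cong: if_cong)

lemma ccoeffs_times_cscalar: "ccoeffs (u * cscalar z) $ C = z * ccoeffs u $ C"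
proof -
  have eq: "sym_diff A C = {} \<longleftrightarrow> A = C" for A by auto
  show ?thesis
    by (simp only: ccoeffs_times ccoeffs_cscalar eq)
      (simp add: if_distrib if_distribR sum.delta cong: if_cong)
qed

lemma cscalar_central: "cscalar z * u = u * cscalar z"
  by (rule clifford_eqI) (simp add: ccoeffs_cscalar_times ccoeffs_times_cscalar)

lemma cscalar_1 [simp]: "cscalar 1 = 1"
  by (rule clifford_eqI) (simp add: ccoeffs_cscalar ccoeffs_one)

lemma cscalar_add: "cscalar (z + w) = cscalar z + cscalar w"
  by (rule clifford_eqI) (simp add: ccoeffs_cscalar plus_clifford.rep_eq)

lemma cscalar_mult: "cscalar (z * w) = cscalar z * cscalar w"
  by (rule clifford_eqI) (simp add: ccoeffs_cscalar_times, simp add: ccoeffs_cscalar)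

lemma cscalar_of_real: "cscalar (of_real r) = of_real r"
  by (rule clifford_eqI)
    (simp add: ccoeffs_cscalar of_real_def scaleR_clifford.rep_eq ccoeffs_one)

lemma ccoeffs_blade_times:
  "ccoeffs (blade A * u) $ C = blade_sign A (sym_diff A C) * ccoeffs u $ sym_diff A C"
proof -
  have "ccoeffs (blade A * u) $ C = (\<Sum>A'\<in>UNIV. if A' = A
      then blade_sign A' (sym_diff A' C) * ccoeffs u $ sym_diff A' C else 0)"
    unfolding ccoeffs_times ccoeffs_blade by (intro sum.cong refl) simp
  then show ?thesis by simp
qed

lemma blade_times_blade:
  "blade A * blade B = cscalar (blade_sign A B) * blade (sym_diff A B)"
proof (rule clifford_eqI)
  fix C
  have "sym_diff A C = B \<longleftrightarrow> C = sym_diff A B" by blast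
  then show "ccoeffs (blade A * blade B) $ C
      = ccoeffs (cscalar (blade_sign A B) * blade (sym_diff A B)) $ C"
    unfolding ccoeffs_blade_times ccoeffs_cscalar_times ccoeffs_blade by auto
qed

theorem cgen_anticommute:
  "cgen i * cgen j + cgen j * cgen i = (if i = j then -2 else 0)"
proof (cases "i = j")
  case True
  have "cgen j * cgen j = (-1 :: 'a clifford)"
    by (rule clifford_eqI)
      (simp add: cgen_def blade_times_blade ccoeffs_cscalar_times ccoeffs_blade blade_sign_prod
        ccoeffs_one uminus_clifford.rep_eq)
  with True show ?thesis by simp
next
  case False
  then have "sym_diff {i} {j} = {i, j}" "sym_diff {j} {i} = {i, j}" by auto
  with False show ?thesis
    by (intro clifford_eqI)
      (auto simp: cgen_def blade_times_blade ccoeffs_cscalar_times plus_clifford.rep_eq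
        blade_sign_prod zero_clifford.rep_eq)
qed

lemma blade_insert:
  assumes "\<And>a. a \<in> A \<Longrightarrow> i < a"
  shows "blade (insert i A) = cgen i * blade A"
proof -
  have "i \<notin> A" using assms by auto
  then have "sym_diff {i} A = insert i A" by auto
  moreover have "blade_sign {i} A = 1"
    using assms by (auto simp: blade_sign_prod not_le intro!: prod.neutral)
  ultimately show ?thesis
    by (simp add: cgen_def blade_times_blade)
qed


section \<open>Generators for \<open>\<real>\<^sup>p \<times> \<real>\<^sup>q\<close>\<close>

text \<open>
  With \<open>CARD('p) = p\<close> and \<open>CARD('q) = q\<close> the generators are indexed by \<open>'p + 'q\<close>, with \<open>'p\<close>
  placed before \<open>'q\<close>: \<open>Inl j\<close> stands for \<open>j\<close> and \<open>Inr j\<close> for \<open>p + j\<close>.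
\<close>

instantiation sum :: (linorder, linorder) linorder
begin

fun less_eq_sum :: "'a + 'b \<Rightarrow> 'a + 'b \<Rightarrow> bool" where
  "Inl a \<le> Inl b \<longleftrightarrow> a \<le> b"
| "Inl a \<le> Inr b \<longleftrightarrow> True"
| "Inr a \<le> Inl b \<longleftrightarrow> False"
| "Inr a \<le> Inr b \<longleftrightarrow> a \<le> b"

definition less_sum :: "'a + 'b \<Rightarrow> 'a + 'b \<Rightarrow> bool"
  where "less_sum x y \<longleftrightarrow> x \<le> y \<and> \<not> y \<le> x"

instance
proof
  fix x y z :: "'a + 'b"
  show "x < y \<longleftrightarrow> x \<le> y \<and> \<not> y \<le> x" by (rule less_sum_def)
  show "x \<le> x" by (cases x) auto
  show "x \<le> y \<Longrightarrow> y \<le> z \<Longrightarrow> x \<le> z" by (cases x; cases y; cases z) auto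
  show "x \<le> y \<Longrightarrow> y \<le> x \<Longrightarrow> x = y" by (cases x; cases y) auto
  show "x \<le> y \<or> y \<le> x" by (cases x; cases y) auto
qed

end

definition vec_p :: "real ^ 'p::finite \<Rightarrow> ('p + 'q::finite) clifford"
  where "vec_p x = (\<Sum>j\<in>UNIV. x $ j *\<^sub>R cgen (Inl j))"


section \<open>The surface measure of the unit sphere\<close>

text \<open>
  The surface element of the unit sphere is normalised as the cone measure: a Borel set
  \<open>A\<close> of unit vectors in an \<open>n\<close>-dimensional space has surface measure \<open>n\<close> times the volume of
  \<open>{r u. 0 < r \<le> 1, u \<in> A}\<close>, which is the preimage of \<open>A\<close> under \<open>sgn x = x / norm x\<close> within the
  unit ball. In dimension 1 this is the counting measure on \<open>{-1, 1}\<close>.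
\<close>

definition sphere_measure :: "'a::euclidean_space measure"
  where "sphere_measure = scale_measure (of_nat DIM('a))
    (distr (restrict_space lborel (cball 0 1 - {0})) (restrict_space borel (sphere 0 1)) sgn)"

lemma space_sphere_measure: "space (sphere_measure :: 'a::euclidean_space measure) = sphere 0 1"
  by (simp add: sphere_measure_def space_scale_measure space_restrict_space)

lemma sgn_measurable_sphere:
  "sgn \<in> measurable (restrict_space lborel (cball 0 1 - {0 :: 'a::euclidean_space}))
    (restrict_space borel (sphere 0 1))"
proof (rule measurable_restrict_space2)
  show "sgn \<in> space (restrict_space lborel (cball 0 1 - {0 :: 'a})) \<rightarrow> sphere 0 1"
    by (auto simp: space_restrict_space norm_sgn)
  have "(\<lambda>x :: 'a. x /\<^sub>R norm x) \<in> borel_measurable borel" by measurable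
  then show "sgn \<in> borel_measurable (restrict_space lborel (cball 0 1 - {0 :: 'a}))"
    by (simp add: sgn_div_norm[abs_def] measurable_restrict_space1)
qed

lemma emeasure_sphere_measure:
  fixes A :: "'a::euclidean_space set"
  assumes "A \<in> sets borel" "A \<subseteq> sphere 0 1"
  shows "emeasure sphere_measure A
    = of_nat DIM('a) * emeasure lborel {r *\<^sub>R u | r u. 0 < r \<and> r \<le> 1 \<and> u \<in> A}"
proof -
  have "A \<in> sets (restrict_space borel (sphere 0 1))"
    using assms by (auto simp: sets_restrict_space_iff)
  then have "emeasure sphere_measure A = of_nat DIM('a)
      * emeasure (restrict_space lborel (cball 0 1 - {0})) (sgn -` A \<inter> (cball 0 1 - {0}))"
    unfolding sphere_measure_def
    by (simp add: emeasure_distr[OF sgn_measurable_sphere] space_restrict_space)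
  also have "emeasure (restrict_space lborel (cball 0 1 - {0})) (sgn -` A \<inter> (cball 0 1 - {0}))
      = emeasure lborel (sgn -` A \<inter> (cball 0 1 - {0 :: 'a}))"
    by (rule emeasure_restrict_space) auto
  also have "sgn -` A \<inter> (cball 0 1 - {0 :: 'a}) = {r *\<^sub>R u | r u. 0 < r \<and> r \<le> 1 \<and> u \<in> A}"
  proof (intro equalityI subsetI)
    fix x assume "x \<in> sgn -` A \<inter> (cball 0 1 - {0 :: 'a})"
    then have "x = norm x *\<^sub>R sgn x" "0 < norm x" "norm x \<le> 1" "sgn x \<in> A"
      by (auto simp: sgn_div_norm)
    then show "x \<in> {r *\<^sub>R u | r u. 0 < r \<and> r \<le> 1 \<and> u \<in> A}" by blast
  next
    fix x assume "x \<in> {r *\<^sub>R u | r u. 0 < r \<and> r \<le> 1 \<and> u \<in> A}"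
    then obtain r u where "x = r *\<^sub>R u" "0 < r" "r \<le> 1" "u \<in> A" by blast
    moreover have "norm u = 1" using \<open>u \<in> A\<close> assms by auto
    ultimately show "x \<in> sgn -` A \<inter> (cball 0 1 - {0})"
      by (auto simp: sgn_div_norm)
  qed
  finally show ?thesis .
qed

lemma measure_sphere:
  "measure sphere_measure (sphere (0 :: 'a::euclidean_space) 1)
    = DIM('a) * unit_ball_vol (DIM('a))"
proof -
  have "{r *\<^sub>R u | r u. 0 < r \<and> r \<le> 1 \<and> u \<in> sphere (0 :: 'a) 1} = cball 0 1 - {0}"
  proof (intro equalityI subsetI)
    fix x :: 'a assume "x \<in> cball 0 1 - {0}"
    then have "x = norm x *\<^sub>R sgn x" "0 < norm x" "norm x \<le> 1" "sgn x \<in> sphere 0 1"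
      by (auto simp: sgn_div_norm)
    then show "x \<in> {r *\<^sub>R u | r u. 0 < r \<and> r \<le> 1 \<and> u \<in> sphere (0 :: 'a) 1}" by blast
  qed auto
  moreover have "emeasure lborel (cball 0 1 - {0 :: 'a}) = emeasure lborel (cball (0 :: 'a) 1)"
    by (subst emeasure_Diff) auto
  ultimately have "emeasure sphere_measure (sphere (0 :: 'a) 1)
      = of_nat DIM('a) * emeasure lborel (cball (0 :: 'a) 1)"
    using emeasure_sphere_measure[of "sphere (0 :: 'a) 1"] by simp
  then show ?thesis
    by (simp add: measure_def emeasure_cball enn2real_mult)
qed

end

theory Submission
  imports Defs
begin

text \<open>
  Expand the power by the binomial theorem. The integral becomes a combination of the vector moments
  \<open>\<integral> (x \<bullet> t) ^ n t dS(t)\<close> with coefficients that are central scalars. The symmetries of the sphere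
  determine these moments up to one number: \<open>t \<mapsto> - t\<close> kills the even \<open>n\<close>, and for odd \<open>n\<close> the
  half-turn about the line through \<open>x\<close> shows that the moment is the multiple of \<open>x\<close> whose inner
  product with \<open>x\<close> is \<open>\<integral> (x \<bullet> t) ^ (n + 1) dS(t)\<close>
  (\<open>integral_sphere_measure_vector_moment\<close>). For \<open>n = 2 j + 1\<close> this is a scalar times
  \<open>(x \<bullet> x) ^ j x\<close>, which up to the sign \<open>(-1) ^ j\<close> is the Clifford power \<open>x ^ (2 j + 1)\<close>, because
  a Clifford vector squares to \<open>- (x \<bullet> x)\<close>.

  The scalar moments come from the classical comparison with a Gaussian. If \<open>f\<close> is nonnegative and
  homogeneous of degree \<open>d\<close> on a space of dimension \<open>p\<close>, then
  \<open>2 \<integral> f(x) exp (- \<bar>x\<bar>\<^sup>2) dx = \<Gamma>((p + d) / 2) \<integral> f dS\<close>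
  (\<open>nn_integral_homogeneous_gaussian\<close>). For the cone measure this holds because the Gaussian, and
  the weight \<open>1 / \<bar>x\<bar> ^ d\<close> that turns \<open>f(x)\<close> into \<open>f(x / \<bar>x\<bar>)\<close>, are superpositions of indicators of
  balls, and homogeneity scales each ball to the unit ball. For \<open>f\<close> a power of a
  coordinate the Gaussian integral is a product of one-dimensional ones, which the same identity
  evaluates in dimension one; other directions follow by the orthogonal invariance of the cone
  measure (\<open>distr_sphere_measure_orthogonal\<close>).
\<close>

section \<open>Homogeneous functions against radial weights\<close>

lemma nn_integral_homogeneous_cball:
  fixes f :: "'a::euclidean_space \<Rightarrow> ennreal"
  assumes [measurable]: "f \<in> borel_measurable borel"
    and hom: "\<And>r x. r > 0 \<Longrightarrow> f (r *\<^sub>R x) = ennreal (r ^ d) * f x"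
    and "r \<ge> 0"
  shows "(\<integral>\<^sup>+x. f x * indicator (cball 0 r) x \<partial>lborel)
    = ennreal (r ^ (d + DIM('a))) * (\<integral>\<^sup>+x. f x * indicator (cball 0 1) x \<partial>lborel)"
proof (cases "r = 0")
  case True
  have "AE x in lborel. x \<noteq> (0 :: 'a)"
    by (rule AE_lborel_singleton)
  then have "AE x in lborel. f x * indicator (cball 0 r) x = 0"
    by eventually_elim (simp add: True)
  then have "(\<integral>\<^sup>+x. f x * indicator (cball 0 r) x \<partial>lborel) = 0"
    by (subst nn_integral_cong_AE[where v = "\<lambda>_. 0"]) auto
  then show ?thesis by (simp add: True power_add)
next
  case False
  with \<open>r \<ge> 0\<close> have "r > 0" by simp
  then have lborel: "lborel = density (distr lborel borel (\<lambda>x :: 'a. r *\<^sub>R x))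
      (\<lambda>_. ennreal (r ^ DIM('a)))"
    using lborel_affine[of r "0 :: 'a"] by simp
  have [measurable]: "cball (0 :: 'a) c \<in> sets borel" for c by simp
  have "(\<integral>\<^sup>+x. f x * indicator (cball 0 r) x \<partial>lborel)
      = (\<integral>\<^sup>+x. ennreal (r ^ DIM('a)) * (f (r *\<^sub>R x) * indicator (cball 0 r) (r *\<^sub>R x)) \<partial>lborel)"
    using \<open>r > 0\<close>
    by (subst lborel) (simp add: nn_integral_density nn_integral_distr)
  also have "\<dots> = (\<integral>\<^sup>+x. ennreal (r ^ (d + DIM('a))) * (f x * indicator (cball 0 1) x) \<partial>lborel)"
    using \<open>r > 0\<close>
    by (intro nn_integral_cong)
      (auto simp: hom power_add ennreal_mult'' mult_ac split: split_indicator)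
  also have "\<dots> = ennreal (r ^ (d + DIM('a))) * (\<integral>\<^sup>+x. f x * indicator (cball 0 1) x \<partial>lborel)"
    by (rule nn_integral_cmult) measurable
  finally show ?thesis .
qed

text \<open>
  Any radial weight that arises by superposing indicators of balls can be integrated against \<open>f\<close>
  by swapping the two integrals: the inner one is then the integral of \<open>f\<close> over a ball of radius
  \<open>\<sigma> u\<close>, which homogeneity reduces to the unit ball. The weights used below are a Gaussian and a
  negative power of the norm cut off at the unit sphere; both decrease in the norm, so their
  densities \<open>\<rho>\<close> are nonnegative and the swap is Tonelli's theorem.
\<close>
lemma nn_integral_homogeneous_weight:
  fixes f :: "'a::euclidean_space \<Rightarrow> ennreal" and \<rho> :: "real \<Rightarrow> ennreal" and \<sigma> :: "real \<Rightarrow> real"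
  assumes [measurable]: "f \<in> borel_measurable borel" "\<rho> \<in> borel_measurable borel"
      "\<sigma> \<in> borel_measurable borel"
    and hom: "\<And>r x. r > 0 \<Longrightarrow> f (r *\<^sub>R x) = ennreal (r ^ d) * f x"
    and \<sigma>: "\<And>u. \<sigma> u \<ge> 0"
  shows "(\<integral>\<^sup>+x. f x * (\<integral>\<^sup>+u. \<rho> u * indicator {norm x..} (\<sigma> u) \<partial>lborel) \<partial>lborel)
    = (\<integral>\<^sup>+u. \<rho> u * ennreal (\<sigma> u ^ (d + DIM('a))) \<partial>lborel)
      * (\<integral>\<^sup>+x. f x * indicator (cball 0 1) x \<partial>lborel)"
proof -
  have [measurable]: "(\<lambda>(x :: 'a, u). indicator {norm x..} (\<sigma> u) :: ennreal)
      \<in> borel_measurable (borel \<Otimes>\<^sub>M borel)"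
  proof -
    have "(\<lambda>(x :: 'a, u). indicator {norm x..} (\<sigma> u) :: ennreal)
        = (\<lambda>p. if norm (fst p) \<le> \<sigma> (snd p) then 1 else 0)"
      by (auto simp: fun_eq_iff)
    then show ?thesis by simp
  qed
  have [measurable]: "cball (0 :: 'a) r \<in> sets borel" for r by simp
  have "(\<integral>\<^sup>+x. f x * (\<integral>\<^sup>+u. \<rho> u * indicator {norm x..} (\<sigma> u) \<partial>lborel) \<partial>lborel)
      = (\<integral>\<^sup>+x. \<integral>\<^sup>+u. f x * (\<rho> u * indicator {norm x..} (\<sigma> u)) \<partial>lborel \<partial>lborel)"
    by (intro nn_integral_cong nn_integral_cmult[symmetric]) measurable
  also have "\<dots> = (\<integral>\<^sup>+u. \<integral>\<^sup>+x. f x * (\<rho> u * indicator {norm x..} (\<sigma> u)) \<partial>lborel \<partial>lborel)"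
    by (rule lborel_pair.Fubini') measurable
  also have "\<dots> = (\<integral>\<^sup>+u. \<integral>\<^sup>+x. \<rho> u * (f x * indicator (cball 0 (\<sigma> u)) x) \<partial>lborel \<partial>lborel)"
    by (intro nn_integral_cong) (auto simp: mult_ac split: split_indicator)
  also have "\<dots> = (\<integral>\<^sup>+u. \<rho> u * (\<integral>\<^sup>+x. f x * indicator (cball 0 (\<sigma> u)) x \<partial>lborel) \<partial>lborel)"
    by (intro nn_integral_cong nn_integral_cmult) measurable
  also have "\<dots> = (\<integral>\<^sup>+u. \<rho> u * ennreal (\<sigma> u ^ (d + DIM('a)))
      * (\<integral>\<^sup>+x. f x * indicator (cball 0 1) x \<partial>lborel) \<partial>lborel)"
    by (simp add: nn_integral_homogeneous_cball[OF _ hom \<sigma>] mult.assoc)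
  also have "\<dots> = (\<integral>\<^sup>+u. \<rho> u * ennreal (\<sigma> u ^ (d + DIM('a))) \<partial>lborel)
      * (\<integral>\<^sup>+x. f x * indicator (cball 0 1) x \<partial>lborel)"
    by (rule nn_integral_multc) measurable
  finally show ?thesis .
qed

lemma nn_integral_exp_tail:
  "(\<integral>\<^sup>+u. ennreal (exp (- u)) * indicator {a..} u \<partial>lborel) = ennreal (exp (- a))"
proof -
  have "((\<lambda>u. - exp (- u :: real)) \<longlongrightarrow> - 0) at_top"
    by (intro tendsto_minus filterlim_compose[OF exp_at_bot] filterlim_uminus_at_bot_at_top)
  then have "(\<integral>\<^sup>+u. ennreal (exp (- u)) * indicator {a..} u \<partial>lborel) = ennreal (- 0 - (- exp (- a)))"
    by (intro nn_integral_FTC_atLeast) (auto intro!: derivative_eq_intros)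
  then show ?thesis by simp
qed

text \<open>
  The Gaussian is the superposition \<open>exp (- r\<^sup>2) = \<integral> exp (- u) du\<close> over \<open>u \<ge> r\<^sup>2\<close>, that is, over the
  balls of radius \<open>sqrt u\<close> that contain a point of norm \<open>r\<close>. With this parametrisation the integral
  over \<open>u\<close> is Euler's integral for the Gamma function as it stands.
\<close>
lemma nn_integral_homogeneous_gaussian_cball:
  fixes f :: "'a::euclidean_space \<Rightarrow> ennreal"
  assumes [measurable]: "f \<in> borel_measurable borel"
    and hom: "\<And>r x. r > 0 \<Longrightarrow> f (r *\<^sub>R x) = ennreal (r ^ d) * f x"
  shows "(\<integral>\<^sup>+x. f x * ennreal (exp (- (norm x)\<^sup>2)) \<partial>lborel)
    = ennreal (Gamma ((real DIM('a) + real d) / 2 + 1)) * (\<integral>\<^sup>+x. f x * indicator (cball 0 1) x \<partial>lborel)"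
proof -
  let ?\<rho> = "\<lambda>u. ennreal (exp (- u)) * indicator {0..} u"
  \<comment> \<open>The absolute value keeps the radius nonnegative where the weight \<open>?\<rho>\<close> vanishes.\<close>
  let ?\<sigma> = "\<lambda>u. sqrt \<bar>u\<bar>"
  have weight: "(\<integral>\<^sup>+u. ?\<rho> u * indicator {norm x..} (?\<sigma> u) \<partial>lborel)
      = ennreal (exp (- (norm x)\<^sup>2))" for x :: 'a
  proof -
    have "norm x \<le> sqrt u \<longleftrightarrow> (norm x)\<^sup>2 \<le> u" if "u \<ge> 0" for u
      using real_sqrt_le_iff[of "(norm x)\<^sup>2" u] by simp
    moreover have "(norm x)\<^sup>2 \<le> u \<Longrightarrow> 0 \<le> u" for u
      by (meson order_trans zero_le_power2)
    ultimately have "(\<integral>\<^sup>+u. ?\<rho> u * indicator {norm x..} (?\<sigma> u) \<partial>lborel)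
        = (\<integral>\<^sup>+u. ennreal (exp (- u)) * indicator {(norm x)\<^sup>2..} u \<partial>lborel)"
      by (intro nn_integral_cong) (auto split: split_indicator)
    then show ?thesis by (simp only: nn_integral_exp_tail)
  qed
  have pow: "sqrt u ^ (d + DIM('a)) = u powr ((real DIM('a) + real d) / 2)" if "u > 0" for u
    using that by (simp add: powr_half_sqrt[symmetric] powr_powr powr_realpow[symmetric] add.commute)
  have "(\<integral>\<^sup>+u. ?\<rho> u * ennreal (?\<sigma> u ^ (d + DIM('a))) \<partial>lborel)
      = (\<integral>\<^sup>+u. ennreal (indicator {0..} u * u powr ((real DIM('a) + real d) / 2 + 1 - 1) / exp u) \<partial>lborel)"
  proof (rule nn_integral_cong)
    fix u :: real
    show "?\<rho> u * ennreal (?\<sigma> u ^ (d + DIM('a)))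
        = ennreal (indicator {0..} u * u powr ((real DIM('a) + real d) / 2 + 1 - 1) / exp u)"
    proof (cases "u > 0")
      case True
      then show ?thesis
        by (simp add: pow[OF True] ennreal_mult'[symmetric], simp add: exp_minus field_simps)
    next
      case False
      then have "u < 0 \<or> u = 0" by auto
      then show ?thesis by (elim disjE) simp_all
    qed
  qed
  also have "\<dots> = ennreal (Gamma ((real DIM('a) + real d) / 2 + 1))"
    by (rule Gamma_conv_nn_integral_real[symmetric]) (simp add: add_nonneg_pos)
  finally show ?thesis
    using nn_integral_homogeneous_weight[of f ?\<rho> ?\<sigma> d] by (simp add: hom weight)
qed

section \<open>Surface integrals of homogeneous functions\<close>

lemma nn_integral_sphere_measure:
  fixes f :: "'a::euclidean_space \<Rightarrow> ennreal"
  assumes [measurable]: "f \<in> borel_measurable borel"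
  shows "(\<integral>\<^sup>+t. f t \<partial>sphere_measure)
    = of_nat DIM('a) * (\<integral>\<^sup>+x. f (sgn x) * indicator (cball 0 1 - {0}) x \<partial>lborel)"
proof -
  have f: "f \<in> borel_measurable (restrict_space borel (sphere 0 1))"
    by (rule measurable_restrict_space1) measurable
  have "(\<integral>\<^sup>+t. f t \<partial>sphere_measure)
      = of_nat DIM('a) * (\<integral>\<^sup>+x. f (sgn x) \<partial>restrict_space lborel (cball 0 1 - {0}))"
    unfolding sphere_measure_def
    using f by (simp add: nn_integral_scale_measure nn_integral_distr[OF sgn_measurable_sphere])
  then show ?thesis
    by (simp add: nn_integral_restrict_space)
qed

lemma nn_integral_power_tail:
  fixes a :: real
  assumes "a > 0" "d > 0"
  shows "(\<integral>\<^sup>+u. ennreal (d / u ^ (d + 1)) * indicator {a..} u \<partial>lborel) = ennreal (1 / a ^ d)"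
proof -
  have "((\<lambda>u :: real. - inverse (u ^ d)) \<longlongrightarrow> - 0) at_top"
    by (intro tendsto_minus tendsto_inverse_0_at_top filterlim_pow_at_top[OF \<open>d > 0\<close> filterlim_ident])
  moreover have "((\<lambda>u. - inverse (u ^ d)) has_real_derivative d / u ^ (d + 1)) (at u)"
    if "a \<le> u" for u
  proof -
    obtain m where "d = Suc m" using \<open>d > 0\<close> by (cases d) auto
    have "u \<noteq> 0" using that \<open>a > 0\<close> by simp
    then have "((\<lambda>u. - inverse (u ^ d)) has_real_derivative
        - (- (real d * u ^ (d - Suc 0) * inverse ((u ^ d) ^ Suc (Suc 0))))) (at u)"
      by (intro DERIV_minus DERIV_inverse_fun DERIV_pow) simp
    also have "- (- (real d * u ^ (d - Suc 0) * inverse ((u ^ d) ^ Suc (Suc 0)))) = d / u ^ (d + 1)"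
      using \<open>u \<noteq> 0\<close> by (simp add: \<open>d = Suc m\<close> field_simps)
    finally show ?thesis .
  qed
  ultimately have "(\<integral>\<^sup>+u. ennreal (d / u ^ (d + 1)) * indicator {a..} u \<partial>lborel)
      = ennreal (- 0 - (- inverse (a ^ d)))"
    using \<open>a > 0\<close> by (intro nn_integral_FTC_atLeast) auto
  then show ?thesis by (simp add: inverse_eq_divide)
qed

text \<open>
  The factor by which the weight \<open>1 / r ^ d\<close> on the unit ball multiplies the integral of a homogeneous
  function there; \<open>n\<close> is degree plus dimension, so a ball of radius \<open>u\<close> counts as \<open>u ^ n\<close> unit balls.
  The radii \<open>u < 1\<close> contribute \<open>d / (n - d)\<close>, and all \<open>u \<ge> 1\<close> stand for the unit ball itself and
  contribute \<open>1\<close>.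
\<close>
lemma nn_integral_power_weight:
  assumes "d > 0" "n > d"
  shows "(\<integral>\<^sup>+u. ennreal (d / u ^ (d + 1)) * indicator {0<..} u * ennreal (min 1 \<bar>u\<bar> ^ n) \<partial>lborel)
    = ennreal (n / (n - d))"
proof -
  obtain k where n: "n = d + Suc k"
    using \<open>n > d\<close> less_imp_Suc_add by fastforce
  have "AE u in lborel. u \<noteq> (0 :: real)" "AE u in lborel. u \<noteq> (1 :: real)"
    by (rule AE_lborel_singleton)+
  then have "AE u in lborel.
      ennreal (d / u ^ (d + 1)) * indicator {0<..} u * ennreal (min 1 \<bar>u\<bar> ^ n)
      = ennreal (d * u ^ k) * indicator {0..1} u + ennreal (d / u ^ (d + 1)) * indicator {1..} u"
  proof eventually_elim
    case (elim u)
    have eq: "d / (u * u ^ d) * u ^ n = d * u ^ k" if "u > 0"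
      using that by (simp add: n power_add field_simps)
    consider "u < 0" | "0 < u" "u < 1" | "u > 1" using elim by linarith
    then show ?case
      by cases (simp_all add: ennreal_mult'[symmetric] eq[simplified])
  qed
  then have "(\<integral>\<^sup>+u. ennreal (d / u ^ (d + 1)) * indicator {0<..} u * ennreal (min 1 \<bar>u\<bar> ^ n) \<partial>lborel)
      = (\<integral>\<^sup>+u. ennreal (d * u ^ k) * indicator {0..1} u
          + ennreal (d / u ^ (d + 1)) * indicator {1..} u \<partial>lborel)"
    by (rule nn_integral_cong_AE)
  also have "\<dots> = (\<integral>\<^sup>+u. ennreal (d * u ^ k) * indicator {0..1} u \<partial>lborel)
      + (\<integral>\<^sup>+u. ennreal (d / u ^ (d + 1)) * indicator {1..} u \<partial>lborel)"
    by (rule nn_integral_add) auto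
  also have "(\<integral>\<^sup>+u. ennreal (d * u ^ k) * indicator {0..1} u \<partial>lborel)
      = ennreal (d / Suc k * 1 ^ Suc k - d / Suc k * 0 ^ Suc k)"
  proof (rule nn_integral_FTC_Icc)
    show "((\<lambda>u. d / Suc k * u ^ Suc k) has_real_derivative d * u ^ k) (at u)" for u :: real
      using DERIV_cmult[OF DERIV_pow[of "Suc k" u], of "d / Suc k"] by (simp del: of_nat_Suc)
  qed auto
  also have "(\<integral>\<^sup>+u. ennreal (d / u ^ (d + 1)) * indicator {1..} u \<partial>lborel) = ennreal 1"
    using \<open>d > 0\<close> by (subst nn_integral_power_tail) auto
  also have "ennreal (d / Suc k * 1 ^ Suc k - d / Suc k * 0 ^ Suc k) + ennreal 1
      = ennreal (d / Suc k * 1 ^ Suc k - d / Suc k * 0 ^ Suc k + 1)"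
    by (rule ennreal_plus[symmetric]) auto
  also have "d / Suc k * 1 ^ Suc k - d / Suc k * 0 ^ Suc k + 1 = real n / (real n - real d)"
    by (simp add: n field_simps)
  finally show ?thesis .
qed

text \<open>
  By its definition the surface integral of \<open>f\<close> is, up to the factor \<open>DIM('a)\<close>, the integral over
  the unit ball of \<open>x \<mapsto> f (sgn x)\<close>, which is \<open>f x / norm x ^ d\<close> by homogeneity. So this is another instance of
  integration against a radial weight.
\<close>
lemma nn_integral_sphere_measure_homogeneous:
  fixes f :: "'a::euclidean_space \<Rightarrow> ennreal"
  assumes [measurable]: "f \<in> borel_measurable borel"
    and hom: "\<And>r x. r > 0 \<Longrightarrow> f (r *\<^sub>R x) = ennreal (r ^ d) * f x"
  shows "(\<integral>\<^sup>+t. f t \<partial>sphere_measure)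
    = of_nat (DIM('a) + d) * (\<integral>\<^sup>+x. f x * indicator (cball 0 1) x \<partial>lborel)"
proof -
  have AE: "AE x in lborel. x \<noteq> (0 :: 'a)"
    by (rule AE_lborel_singleton)
  have f_sgn: "f x = ennreal (norm x ^ d) * f (sgn x)" if "x \<noteq> 0" for x
    using hom[of "norm x" "sgn x"] that by (simp add: sgn_div_norm)
  show ?thesis
  proof (cases "d = 0")
    case True
    have "AE x in lborel. f (sgn x) * indicator (cball 0 1 - {0}) x = f x * indicator (cball 0 1) x"
      using AE by eventually_elim (simp add: f_sgn True indicator_def)
    then show ?thesis
      by (simp add: nn_integral_sphere_measure True cong: nn_integral_cong_AE)
  next
    case False
    let ?\<rho> = "\<lambda>u. ennreal (d / u ^ (d + 1)) * indicator {0<..} u"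
    \<comment> \<open>Capping the radius at \<open>1\<close> makes the weight vanish outside the unit ball.\<close>
    let ?\<sigma> = "\<lambda>u :: real. min 1 \<bar>u\<bar>"
    have "AE x in lborel. f (sgn x) * indicator (cball 0 1 - {0}) x
        = f x * (\<integral>\<^sup>+u. ?\<rho> u * indicator {norm x..} (?\<sigma> u) \<partial>lborel)"
      using AE
    proof eventually_elim
      case (elim x)
      then have x: "norm x > 0" by simp
      show ?case
      proof (cases "norm x \<le> 1")
        case True
        have "(\<integral>\<^sup>+u. ?\<rho> u * indicator {norm x..} (?\<sigma> u) \<partial>lborel)
            = (\<integral>\<^sup>+u. ennreal (d / u ^ (d + 1)) * indicator {norm x..} u \<partial>lborel)"
          using True less_le_trans[OF x] by (intro nn_integral_cong) (auto split: split_indicator)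
        also have "\<dots> = ennreal (1 / norm x ^ d)"
          using x False by (intro nn_integral_power_tail) auto
        finally have weight: "(\<integral>\<^sup>+u. ?\<rho> u * indicator {norm x..} (?\<sigma> u) \<partial>lborel)
            = ennreal (1 / norm x ^ d)" .
        have "f x * ennreal (1 / norm x ^ d)
            = ennreal (norm x ^ d) * ennreal (1 / norm x ^ d) * f (sgn x)"
          by (simp only: f_sgn[OF elim] mult_ac)
        also have "ennreal (norm x ^ d) * ennreal (1 / norm x ^ d) = 1"
          using x by (simp add: ennreal_mult'[symmetric])
        finally show ?thesis
          unfolding weight using elim True by simp
      next
        case False
        then have "?\<rho> u * indicator {norm x..} (?\<sigma> u) = 0" for u
          using x by (simp split: split_indicator)
        then show ?thesis
          using False by (simp del: mult_eq_0_iff)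
      qed
    qed
    then have "(\<integral>\<^sup>+x. f (sgn x) * indicator (cball 0 1 - {0}) x \<partial>lborel)
        = (\<integral>\<^sup>+x. f x * (\<integral>\<^sup>+u. ?\<rho> u * indicator {norm x..} (?\<sigma> u) \<partial>lborel) \<partial>lborel)"
      by (rule nn_integral_cong_AE)
    also have "\<dots> = (\<integral>\<^sup>+u. ?\<rho> u * ennreal (?\<sigma> u ^ (d + DIM('a))) \<partial>lborel)
        * (\<integral>\<^sup>+x. f x * indicator (cball 0 1) x \<partial>lborel)"
      by (rule nn_integral_homogeneous_weight) (auto simp: hom)
    also have "(\<integral>\<^sup>+u. ?\<rho> u * ennreal (?\<sigma> u ^ (d + DIM('a))) \<partial>lborel)
        = ennreal (real (d + DIM('a)) / DIM('a))"
      using False by (subst nn_integral_power_weight) auto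
    finally have eq: "(\<integral>\<^sup>+x. f (sgn x) * indicator (cball 0 1 - {0}) x \<partial>lborel)
        = ennreal (real (d + DIM('a)) / DIM('a)) * (\<integral>\<^sup>+x. f x * indicator (cball 0 1) x \<partial>lborel)" .
    have "of_nat DIM('a) * ennreal (real (d + DIM('a)) / DIM('a)) = of_nat (DIM('a) + d)"
      by (simp add: ennreal_of_nat_eq_real_of_nat ennreal_mult'[symmetric] add.commute)
    then show ?thesis
      by (simp only: nn_integral_sphere_measure[OF assms(1)] eq mult.assoc[symmetric])
  qed
qed

text \<open>
  The bridge between the sphere and product measures: a surface integral of a homogeneous function
  becomes a Gaussian integral over the whole space, and that one factorises over the coordinates.
\<close>
lemma nn_integral_homogeneous_gaussian:
  fixes f :: "'a::euclidean_space \<Rightarrow> ennreal"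
  assumes [measurable]: "f \<in> borel_measurable borel"
    and hom: "\<And>r x. r > 0 \<Longrightarrow> f (r *\<^sub>R x) = ennreal (r ^ d) * f x"
  shows "2 * (\<integral>\<^sup>+x. f x * ennreal (exp (- (norm x)\<^sup>2)) \<partial>lborel)
    = ennreal (Gamma ((real DIM('a) + real d) / 2)) * (\<integral>\<^sup>+t. f t \<partial>sphere_measure)"
proof -
  let ?B = "\<integral>\<^sup>+x. f x * indicator (cball 0 1) x \<partial>lborel"
  define a where "a = (real DIM('a) + real d) / 2"
  have a: "a > 0" by (simp add: a_def add_pos_nonneg)
  then have "2 * Gamma (a + 1) = Gamma a * real (DIM('a) + d)"
    by (subst Gamma_plus1) (auto simp: a_def field_simps)
  then have "2 * ennreal (Gamma (a + 1)) = ennreal (Gamma a) * of_nat (DIM('a) + d)"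
    using Gamma_real_pos[OF a]
    by (simp only: ennreal_of_nat_eq_real_of_nat ennreal_mult'[OF less_imp_le, symmetric])
      (metis ennreal_mult' ennreal_numeral zero_le_numeral)
  moreover have "2 * (\<integral>\<^sup>+x. f x * ennreal (exp (- (norm x)\<^sup>2)) \<partial>lborel)
      = 2 * ennreal (Gamma (a + 1)) * ?B"
    by (subst nn_integral_homogeneous_gaussian_cball) (simp_all add: hom a_def mult.assoc)
  ultimately show ?thesis
    by (simp only: nn_integral_sphere_measure_homogeneous[OF assms] a_def mult.assoc)
qed

section \<open>Coordinate moments of the sphere\<close>

lemma emeasure_sphere_measure_real: "emeasure sphere_measure (sphere (0 :: real) 1) = 2"
proof -
  have "sphere (0 :: real) 1 = {-1, 1}" by (auto simp: sphere_def dist_real_def)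
  moreover have "{r *\<^sub>R u | r u. 0 < r \<and> r \<le> 1 \<and> u \<in> {-1, 1 :: real}} = {-1..1} - {0}"
  proof (intro equalityI subsetI)
    fix x :: real assume "x \<in> {-1..1} - {0}"
    then have "x = \<bar>x\<bar> *\<^sub>R sgn x" "0 < \<bar>x\<bar>" "\<bar>x\<bar> \<le> 1" "sgn x \<in> {-1, 1}"
      by (auto simp: sgn_real_def)
    then show "x \<in> {r *\<^sub>R u | r u. 0 < r \<and> r \<le> 1 \<and> u \<in> {-1, 1 :: real}}" by blast
  qed auto
  ultimately show ?thesis
    using emeasure_sphere_measure[of "{-1, 1 :: real}"]
    by (simp add: emeasure_Diff)
qed

text \<open>
  In dimension one the sphere is \<open>{-1, 1}\<close>, where \<open>\<bar>t\<bar> ^ d\<close> is constant, so the bridge read backwards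
  evaluates the one-dimensional Gaussian moments.
\<close>
lemma nn_integral_gaussian_moment:
  "(\<integral>\<^sup>+u. ennreal (\<bar>u\<bar> ^ d * exp (- u\<^sup>2)) \<partial>lborel) = ennreal (Gamma ((real d + 1) / 2))"
proof -
  have "2 * (\<integral>\<^sup>+u. ennreal (\<bar>u\<bar> ^ d) * ennreal (exp (- (norm u)\<^sup>2)) \<partial>lborel)
      = ennreal (Gamma ((real DIM(real) + real d) / 2)) * (\<integral>\<^sup>+t. ennreal (\<bar>t\<bar> ^ d) \<partial>sphere_measure)"
    by (rule nn_integral_homogeneous_gaussian)
      (simp_all add: abs_mult power_mult_distrib ennreal_mult)
  also have "(\<integral>\<^sup>+t. ennreal (\<bar>t\<bar> ^ d) \<partial>(sphere_measure :: real measure))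
      = (\<integral>\<^sup>+t. 1 \<partial>(sphere_measure :: real measure))"
    by (rule nn_integral_cong) (simp add: space_sphere_measure)
  also have "\<dots> = 2"
    by (simp add: space_sphere_measure emeasure_sphere_measure_real)
  finally show ?thesis
    by (simp add: ennreal_mult add.commute mult.commute[of _ "2 :: ennreal"] ennreal_mult_cancel_left)
qed

lemma nn_integral_gaussian_coordinate_moment:
  fixes e :: "'a::euclidean_space"
  assumes "e \<in> Basis"
  shows "(\<integral>\<^sup>+x. ennreal (\<bar>x \<bullet> e\<bar> ^ d) * ennreal (exp (- (norm x)\<^sup>2)) \<partial>lborel)
    = ennreal (Gamma ((real d + 1) / 2) * sqrt pi ^ (DIM('a) - 1))"
proof -
  let ?f = "\<lambda>b u :: real. ennreal (\<bar>u\<bar> ^ (if b = e then d else 0) * exp (- u\<^sup>2))"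
  have "(\<integral>\<^sup>+x. ennreal (\<bar>x \<bullet> e\<bar> ^ d) * ennreal (exp (- (norm x)\<^sup>2)) \<partial>lborel)
      = (\<integral>\<^sup>+x. (\<Prod>b\<in>Basis. ?f b (x \<bullet> b)) \<partial>(lborel :: 'a measure))"
  proof (rule nn_integral_cong)
    fix x :: 'a
    have "(norm x)\<^sup>2 = (\<Sum>b\<in>Basis. (x \<bullet> b)\<^sup>2)"
      unfolding power2_norm_eq_inner by (subst euclidean_inner) (simp add: power2_eq_square)
    then have "exp (- (norm x)\<^sup>2) = (\<Prod>b\<in>Basis. exp (- (x \<bullet> b)\<^sup>2))"
      by (simp only: sum_negf[symmetric] exp_sum[OF finite_Basis])
    moreover have "\<bar>x \<bullet> e\<bar> ^ d = (\<Prod>b\<in>Basis. if b = e then \<bar>x \<bullet> b\<bar> ^ d else 1)"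
      using assms by (simp add: prod.delta')
    moreover have "\<dots> = (\<Prod>b\<in>Basis. \<bar>x \<bullet> b\<bar> ^ (if b = e then d else 0))"
      by (intro prod.cong) auto
    ultimately show "ennreal (\<bar>x \<bullet> e\<bar> ^ d) * ennreal (exp (- (norm x)\<^sup>2)) = (\<Prod>b\<in>Basis. ?f b (x \<bullet> b))"
      by (simp add: prod_ennreal prod.distrib ennreal_mult prod_nonneg)
  qed
  also have "\<dots> = (\<Prod>b\<in>(Basis :: 'a set). \<integral>\<^sup>+u. ?f b u \<partial>lborel)"
    by (rule nn_integral_lborel_prod) auto
  also have "\<dots> = (\<Prod>b\<in>(Basis :: 'a set). ennreal (if b = e then Gamma ((real d + 1) / 2) else sqrt pi))"
    by (intro prod.cong refl)
      (simp only: nn_integral_gaussian_moment, simp add: Gamma_one_half_real add.commute)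
  also have "\<dots> = ennreal (\<Prod>b\<in>(Basis :: 'a set). if b = e then Gamma ((real d + 1) / 2) else sqrt pi)"
    by (rule prod_ennreal) (simp add: Gamma_real_nonneg)
  also have "(\<Prod>b\<in>(Basis :: 'a set). if b = e then Gamma ((real d + 1) / 2) else sqrt pi)
      = Gamma ((real d + 1) / 2) * sqrt pi ^ (DIM('a) - 1)"
    using assms by (subst prod.remove[of _ e]) (simp_all add: card_Diff_singleton)
  finally show ?thesis .
qed

lemma nn_integral_sphere_coordinate_moment:
  fixes e :: "'a::euclidean_space"
  assumes "e \<in> Basis"
  shows "(\<integral>\<^sup>+t. ennreal (\<bar>t \<bullet> e\<bar> ^ d) \<partial>sphere_measure)
    = ennreal (2 * Gamma ((real d + 1) / 2) * sqrt pi ^ (DIM('a) - 1) / Gamma ((real DIM('a) + real d) / 2))"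
    (is "?I = ennreal ?c")
proof -
  define a where "a = Gamma ((real DIM('a) + real d) / 2)"
  have a: "a > 0" unfolding a_def by (intro Gamma_real_pos) (simp add: add_pos_nonneg)
  have "ennreal a * ?I = 2 * (\<integral>\<^sup>+x. ennreal (\<bar>x \<bullet> e\<bar> ^ d) * ennreal (exp (- (norm x)\<^sup>2)) \<partial>lborel)"
    unfolding a_def
    by (rule nn_integral_homogeneous_gaussian[symmetric])
      (simp_all add: abs_mult power_mult_distrib ennreal_mult)
  also have "\<dots> = ennreal (2 * (Gamma ((real d + 1) / 2) * sqrt pi ^ (DIM('a) - 1)))"
    by (simp only: nn_integral_gaussian_coordinate_moment[OF assms] ennreal_numeral[symmetric]
        ennreal_mult'[OF zero_le_numeral])
  also have "2 * (Gamma ((real d + 1) / 2) * sqrt pi ^ (DIM('a) - 1)) = a * ?c"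
  proof -
    have "g = a * (g / a)" for g using a by simp
    from this[of "2 * Gamma ((real d + 1) / 2) * sqrt pi ^ (DIM('a) - 1)"] show ?thesis
      by (simp only: a_def mult.assoc)
  qed
  also have "ennreal (a * ?c) = ennreal a * ennreal ?c"
    using a by (intro ennreal_mult') simp
  finally have "ennreal a * ?I = ennreal a * ennreal ?c" .
  then show ?thesis
    using a by (simp only: ennreal_mult_cancel_left) simp
qed

section \<open>Orthogonal invariance\<close>

lemma nn_integral_lborel_reflect:
  fixes f :: "'a::euclidean_space \<Rightarrow> ennreal"
  assumes [measurable]: "f \<in> borel_measurable borel"
  shows "(\<integral>\<^sup>+x. f (z - x) \<partial>lborel) = (\<integral>\<^sup>+x. f x \<partial>lborel)"
  by (subst lborel_affine[of "-1" z]) (simp_all add: nn_integral_density nn_integral_distr)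

lemma borel_measurable_orthogonal:
  fixes T :: "'a::euclidean_space \<Rightarrow> 'a"
  assumes "orthogonal_transformation T"
  shows "T \<in> borel_measurable borel"
  using orthogonal_transformation_linear[OF assms]
  by (intro borel_measurable_continuous_onI linear_continuous_on)
    (simp add: linear_conv_bounded_linear)

text \<open>
  Lebesgue measure \<open>\<nu>\<close> and its image \<open>\<mu>\<close> under \<open>T\<close> are both translation invariant, and they agree on
  the unit ball \<open>B\<close> because \<open>T\<close> preserves norms. That forces them to be equal: integrate
  \<open>indicator A x * indicator B (T y - x)\<close> over \<open>x\<close> and \<open>y\<close>. Doing \<open>y\<close> first gives
  \<open>\<nu> A * \<nu> B\<close>; replacing \<open>x\<close> by \<open>T y - x\<close> and then doing \<open>y\<close> first gives \<open>\<mu> A * \<nu> B\<close>.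
\<close>
lemma distr_lborel_orthogonal:
  fixes T :: "'a::euclidean_space \<Rightarrow> 'a"
  assumes T: "orthogonal_transformation T"
  shows "distr lborel borel T = lborel"
proof (rule measure_eqI)
  fix A assume "A \<in> sets (distr lborel borel T)"
  then have A [measurable]: "A \<in> sets borel" by simp
  have [measurable]: "T \<in> borel_measurable borel"
    using T by (rule borel_measurable_orthogonal)
  let ?B = "cball (0 :: 'a) 1"
  have [measurable]: "?B \<in> sets borel" by simp
  let ?b = "emeasure lborel ?B"
  \<comment> \<open>Both invariance claims shift by \<open>x = T w\<close>, which is possible since \<open>T\<close> is onto.\<close>
  have inner: "(\<integral>\<^sup>+y. indicator ?B (T y - x) \<partial>lborel) = ?b" for x
  proof -
    obtain w where w: "x = T w"
      using orthogonal_transformation_surj[OF T] by (metis surjD)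
    have "norm (T y - x) = norm (w - y)" for y
      using T by (simp add: w norm_minus_commute orthogonal_transformation_norm
          flip: linear_diff[OF orthogonal_transformation_linear[OF T]])
    then have "(\<integral>\<^sup>+y. indicator ?B (T y - x) \<partial>lborel) = (\<integral>\<^sup>+y. indicator ?B (w - y) \<partial>lborel)"
      by (simp add: indicator_def)
    also have "\<dots> = (\<integral>\<^sup>+y. indicator ?B y \<partial>lborel)"
      by (rule nn_integral_lborel_reflect) measurable
    finally show ?thesis by simp
  qed
  have outer: "(\<integral>\<^sup>+y. indicator A (T y - x) \<partial>lborel) = emeasure (distr lborel borel T) A" for x
  proof -
    obtain w where w: "x = T w"
      using orthogonal_transformation_surj[OF T] by (metis surjD)
    have lin: "linear T" using T by (rule orthogonal_transformation_linear)
    have "T y - x = T (0 - (w - y))" for y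
      by (simp add: w linear_diff[OF lin])
    then have "(\<integral>\<^sup>+y. indicator A (T y - x) \<partial>lborel)
        = (\<integral>\<^sup>+y. indicator A (T (0 - (w - y))) \<partial>lborel)"
      by simp
    also have "\<dots> = (\<integral>\<^sup>+y. indicator A (T (0 - y)) \<partial>lborel)"
      by (rule nn_integral_lborel_reflect) measurable
    also have "\<dots> = (\<integral>\<^sup>+y. indicator A (T y) \<partial>lborel)"
      by (rule nn_integral_lborel_reflect) measurable
    also have "\<dots> = emeasure (distr lborel borel T) A"
      using nn_integral_distr[of T lborel borel "indicator A"] by simp
    finally show ?thesis .
  qed
  have "emeasure lborel A * ?b = (\<integral>\<^sup>+x. indicator A x * ?b \<partial>lborel)"
    by (simp add: nn_integral_multc)
  also have "\<dots> = (\<integral>\<^sup>+x. \<integral>\<^sup>+y. indicator A x * indicator ?B (T y - x) \<partial>lborel \<partial>lborel)"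
    by (subst nn_integral_cmult) (simp_all add: inner)
  also have "\<dots> = (\<integral>\<^sup>+y. \<integral>\<^sup>+x. indicator A x * indicator ?B (T y - x) \<partial>lborel \<partial>lborel)"
    by (rule lborel_pair.Fubini') measurable
  also have "\<dots> = (\<integral>\<^sup>+y. \<integral>\<^sup>+x. indicator A (T y - x) * indicator ?B (T y - (T y - x)) \<partial>lborel \<partial>lborel)"
    by (intro nn_integral_cong nn_integral_lborel_reflect[symmetric]) measurable
  also have "\<dots> = (\<integral>\<^sup>+x. \<integral>\<^sup>+y. indicator A (T y - x) * indicator ?B x \<partial>lborel \<partial>lborel)"
    by (simp, rule lborel_pair.Fubini') measurable
  also have "\<dots> = emeasure (distr lborel borel T) A * ?b"
    by (subst nn_integral_multc) (simp_all add: outer nn_integral_cmult)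
  finally have "?b * emeasure (distr lborel borel T) A = ?b * emeasure lborel A"
    by (simp only: mult.commute)
  moreover have "?b \<noteq> 0" "?b \<noteq> \<infinity>"
    by (simp_all add: emeasure_cball less_imp_neq[OF unit_ball_vol_pos, symmetric])
  ultimately show "emeasure (distr lborel borel T) A = emeasure lborel A"
    by (simp add: ennreal_mult_cancel_left)
qed simp

lemma sets_sphere_measure:
  "sets (sphere_measure :: 'a::euclidean_space measure) = sets (restrict_space borel (sphere 0 1))"
  by (simp add: sphere_measure_def)

text \<open>
  An orthogonal map carries the cone over a set to the cone over its image, so the invariance of
  volume passes to the cone measure.
\<close>
lemma distr_sphere_measure_orthogonal:
  fixes T :: "'a::euclidean_space \<Rightarrow> 'a"
  assumes T: "orthogonal_transformation T"
  shows "T \<in> measurable sphere_measure sphere_measure"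
    and "distr sphere_measure sphere_measure T = sphere_measure"
proof -
  have meas: "T \<in> borel_measurable borel"
    using T by (rule borel_measurable_orthogonal)
  have norm: "norm (T x) = norm x" for x
    using T by (simp add: orthogonal_transformation_norm)
  have "T \<in> measurable (restrict_space borel (sphere 0 1)) (restrict_space borel (sphere 0 1))"
    using meas norm
    by (intro measurable_restrict_space2 measurable_restrict_space1) (auto simp: space_restrict_space)
  then show T_sphere: "T \<in> measurable sphere_measure sphere_measure"
    by (simp add: measurable_cong_sets[OF sets_sphere_measure sets_sphere_measure])
  let ?cone = "\<lambda>A. {r *\<^sub>R u | r u. 0 < r \<and> r \<le> 1 \<and> u \<in> A} :: ('a) set"
  show "distr sphere_measure sphere_measure T = sphere_measure"
  proof (rule measure_eqI)
    fix A assume "A \<in> sets (distr sphere_measure sphere_measure T)"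
    then have A: "A \<in> sets borel" "A \<subseteq> sphere 0 1" and A': "A \<in> sets sphere_measure"
      by (auto simp: sets_sphere_measure sets_restrict_space_iff)
    let ?A' = "T -` A \<inter> space sphere_measure"
    have "?A' \<in> sets sphere_measure"
      using T_sphere A' by (rule measurable_sets)
    then have TA: "?A' \<in> sets borel" "?A' \<subseteq> sphere 0 1"
      by (auto simp: sets_sphere_measure sets_restrict_space_iff)
    have cone_eq: "?cone A = (\<lambda>x. x /\<^sub>R norm x) -` A \<inter> (cball 0 1 - {0})"
      if "A \<subseteq> sphere 0 1" for A
    proof (intro equalityI subsetI)
      fix x assume "x \<in> (\<lambda>x. x /\<^sub>R norm x) -` A \<inter> (cball 0 1 - {0})"
      then have "x = norm x *\<^sub>R (x /\<^sub>R norm x)" "0 < norm x" "norm x \<le> 1" "x /\<^sub>R norm x \<in> A"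
        by auto
      then show "x \<in> ?cone A" by blast
    qed (use that in auto)
    have "(\<lambda>x :: 'a. x /\<^sub>R norm x) \<in> borel_measurable borel" by measurable
    from measurable_sets_borel[OF this A(1)] have cone: "?cone A \<in> sets borel"
      by (simp add: cone_eq[OF A(2)])
    have "?cone ?A' = T -` ?cone A"
    proof -
      have "x /\<^sub>R norm x \<in> sphere 0 1" if "x \<noteq> 0" for x :: "'a"
        using that by simp
      moreover have "T x = 0 \<longleftrightarrow> x = 0" for x
        using norm[of x] by (metis norm_eq_zero)
      ultimately show ?thesis
        unfolding cone_eq[OF A(2)] cone_eq[OF TA(2)]
        using linear_cmul[OF orthogonal_transformation_linear[OF T]]
        by (auto simp: space_sphere_measure norm)
    qed
    then have "emeasure lborel (?cone ?A') = emeasure (distr lborel borel T) (?cone A)"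
      using meas cone by (simp add: emeasure_distr)
    also have "\<dots> = emeasure lborel (?cone A)"
      by (simp only: distr_lborel_orthogonal[OF T])
    finally show "emeasure (distr sphere_measure sphere_measure T) A = emeasure sphere_measure A"
      unfolding emeasure_distr[OF T_sphere A'] emeasure_sphere_measure[OF A]
        emeasure_sphere_measure[OF TA] by simp
  qed simp
qed

lemma finite_measure_sphere_measure: "finite_measure (sphere_measure :: 'a::euclidean_space measure)"
proof
  obtain e :: 'a where "e \<in> Basis" using nonempty_Basis by blast
  \<comment> \<open>The moment of order \<open>0\<close> is the total mass.\<close>
  from nn_integral_sphere_coordinate_moment[OF this, of 0]
  show "emeasure sphere_measure (space (sphere_measure :: 'a measure)) \<noteq> \<infinity>"
    by simp
qed

lemma integrable_sphere_measure:
  fixes f :: "'a::euclidean_space \<Rightarrow> 'b::{banach, second_countable_topology}"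
  assumes "continuous_on (sphere 0 1) f"
  shows "integrable sphere_measure f"
proof -
  interpret finite_measure "sphere_measure :: 'a measure"
    by (rule finite_measure_sphere_measure)
  have "compact (f ` sphere 0 1)"
    using assms by (intro compact_continuous_image) auto
  then obtain B where "norm (f x) \<le> B" if "x \<in> sphere 0 1" for x
    by (meson bounded_iff compact_imp_bounded imageI)
  moreover have "f \<in> borel_measurable sphere_measure"
    using borel_measurable_continuous_on_restrict[OF assms]
    by (simp add: measurable_cong_sets[OF sets_sphere_measure refl])
  ultimately show ?thesis
    by (intro integrable_const_bound[of f B] AE_I2) (simp_all add: space_sphere_measure)
qed

lemma integral_sphere_measure_orthogonal:
  fixes T :: "'a::euclidean_space \<Rightarrow> 'a" and f :: "'a \<Rightarrow> 'b::{banach, second_countable_topology}"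
  assumes T: "orthogonal_transformation T" and f: "continuous_on (sphere 0 1) f"
  shows "(LINT t|sphere_measure. f (T t)) = (LINT t|sphere_measure. f t)"
  using integral_distr[OF distr_sphere_measure_orthogonal(1)[OF T], of f]
    integrable_sphere_measure[OF f]
  by (simp add: distr_sphere_measure_orthogonal(2)[OF T])

section \<open>Moments in an arbitrary direction\<close>

text \<open>
  Some orthogonal map takes a multiple of a basis vector to \<open>x\<close>, so only a coordinate moment has to
  be known.
\<close>
lemma integral_sphere_measure_inner_even_power:
  fixes x :: "real ^ 'n"
  shows "(LINT t|sphere_measure. (x \<bullet> t) ^ (2 * m))
    = norm x ^ (2 * m)
      * (2 * Gamma (real m + 1 / 2) * sqrt pi ^ (CARD('n) - 1) / Gamma (real CARD('n) / 2 + real m))"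
proof -
  obtain e :: "real ^ 'n" where e: "e \<in> Basis" using nonempty_Basis by blast
  then have "norm x = norm (norm x *\<^sub>R e)" by simp
  then obtain T where T: "orthogonal_transformation T" "T (norm x *\<^sub>R e) = x"
    using orthogonal_transformation_exists[of "norm x *\<^sub>R e" x] by metis
  have "x \<bullet> T t = norm x * (t \<bullet> e)" for t
  proof -
    have "x \<bullet> T t = T (norm x *\<^sub>R e) \<bullet> T t" by (simp add: T)
    also have "\<dots> = (norm x *\<^sub>R e) \<bullet> t" using T(1) by (simp only: orthogonal_transformation_def)
    finally show ?thesis by (simp add: inner_commute)
  qed
  then have "(LINT t|sphere_measure. (x \<bullet> t) ^ (2 * m))
      = norm x ^ (2 * m) * (LINT t|sphere_measure. (t \<bullet> e) ^ (2 * m))"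
    using integral_sphere_measure_orthogonal[OF T(1), of "\<lambda>t. (x \<bullet> t) ^ (2 * m)"]
    by (simp add: power_mult_distrib continuous_intros)
  also have "(LINT t|sphere_measure. (t \<bullet> e) ^ (2 * m))
      = enn2real (\<integral>\<^sup>+t. ennreal (\<bar>t \<bullet> e\<bar> ^ (2 * m)) \<partial>sphere_measure)"
    by (subst integral_eq_nn_integral)
      (auto simp: power_even_abs
        intro!: continuous_intros borel_measurable_integrable integrable_sphere_measure)
  also have "\<dots> = 2 * Gamma (real m + 1 / 2) * sqrt pi ^ (CARD('n) - 1)
      / Gamma (real CARD('n) / 2 + real m)"
  proof -
    have eq: "(real (2 * m) + 1) / 2 = real m + 1 / 2"
      "(real DIM(real ^ 'n) + real (2 * m)) / 2 = real CARD('n) / 2 + real m"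
      "DIM(real ^ 'n) - 1 = CARD('n) - 1"
      by (simp_all add: add_divide_distrib)
    have "0 \<le> 2 * Gamma (real m + 1 / 2) * sqrt pi ^ (CARD('n) - 1)
        / Gamma (real CARD('n) / 2 + real m)"
      by (intro divide_nonneg_nonneg mult_nonneg_nonneg Gamma_real_nonneg) (auto intro: add_pos_nonneg)
    then show ?thesis
      by (simp only: nn_integral_sphere_coordinate_moment[OF e] eq enn2real_ennreal)
  qed
  finally show ?thesis .
qed

text \<open>
  The integrand is odd, and the sphere is invariant under \<open>t \<mapsto> - t\<close>.
\<close>
lemma integral_sphere_measure_even_vector_moment:
  fixes x :: "'a::euclidean_space"
  assumes "even n"
  shows "(LINT t|sphere_measure. (x \<bullet> t) ^ n *\<^sub>R t) = 0"
proof -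
  have "orthogonal_transformation (uminus :: 'a \<Rightarrow> 'a)"
    by (simp add: orthogonal_transformation_def linear_iff)
  then have "(LINT t|sphere_measure. (x \<bullet> - t) ^ n *\<^sub>R - t) = (LINT t|sphere_measure. (x \<bullet> t) ^ n *\<^sub>R t)"
    by (rule integral_sphere_measure_orthogonal) (intro continuous_intros)
  then have "2 *\<^sub>R (LINT t|sphere_measure. (x \<bullet> t) ^ n *\<^sub>R t) = 0"
    using assms by (simp only: scaleR_2) (simp add: eq_neg_iff_add_eq_0 flip: neg_eq_iff_add_eq_0)
  then show ?thesis by (simp only: scaleR_eq_0_iff) simp
qed

text \<open>
  The vector moment is a multiple of \<open>x\<close> by symmetry. Concretely, let \<open>R\<close> be the orthogonal map that
  fixes \<open>x\<close> and is \<open>-1\<close> on its orthogonal complement. Replacing \<open>t\<close> by \<open>R t\<close> does not change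
  \<open>x \<bullet> t\<close>, and \<open>t + R t\<close> is twice the projection of \<open>t\<close> onto the line through \<open>x\<close>.
\<close>
lemma integral_sphere_measure_vector_moment:
  fixes x :: "'a::euclidean_space"
  shows "(x \<bullet> x) *\<^sub>R (LINT t|sphere_measure. (x \<bullet> t) ^ n *\<^sub>R t)
    = (LINT t|sphere_measure. (x \<bullet> t) ^ Suc n) *\<^sub>R x"
proof (cases "x = 0")
  case False
  define R where "R t = (2 * (x \<bullet> t) / (x \<bullet> x)) *\<^sub>R x - t" for t
  have R: "orthogonal_transformation R"
    unfolding orthogonal_transformation_def
  proof
    show "linear R"
      by (rule linearI)
        (simp_all add: R_def inner_add_right ring_distribs add_divide_distrib scaleR_add_left
          scaleR_diff_right algebra_simps)
    show "\<forall>v w. R v \<bullet> R w = v \<bullet> w"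
      using False by (simp add: R_def inner_diff_left inner_diff_right inner_commute)
  qed
  have xR: "x \<bullet> R t = x \<bullet> t" for t
    using False by (simp add: R_def inner_diff_right)
  let ?I = "LINT t|sphere_measure. (x \<bullet> t) ^ n *\<^sub>R t"
  have "?I = (LINT t|sphere_measure. (x \<bullet> R t) ^ n *\<^sub>R R t)"
    by (rule integral_sphere_measure_orthogonal[OF R, symmetric]) (intro continuous_intros)
  also have "\<dots> = (LINT t|sphere_measure. (2 / (x \<bullet> x) * (x \<bullet> t) ^ Suc n) *\<^sub>R x - (x \<bullet> t) ^ n *\<^sub>R t)"
    by (simp only: xR) (simp add: R_def scaleR_diff_right mult_ac)
  also have "\<dots> = (LINT t|sphere_measure. (2 / (x \<bullet> x) * (x \<bullet> t) ^ Suc n) *\<^sub>R x) - ?I"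
    by (intro Bochner_Integration.integral_diff integrable_sphere_measure continuous_intros)
  also have "(LINT t|sphere_measure. (2 / (x \<bullet> x) * (x \<bullet> t) ^ Suc n) *\<^sub>R x)
      = (2 / (x \<bullet> x) * (LINT t|sphere_measure. (x \<bullet> t) ^ Suc n)) *\<^sub>R x"
    by (subst integral_scaleR_left)
      (auto intro!: integrable_sphere_measure continuous_intros simp del: power_Suc)
  finally have "2 *\<^sub>R ?I = (2 / (x \<bullet> x) * (LINT t|sphere_measure. (x \<bullet> t) ^ Suc n)) *\<^sub>R x"
    by (simp add: scaleR_2 algebra_simps)
  then have "((x \<bullet> x) / 2) *\<^sub>R 2 *\<^sub>R ?I
      = ((x \<bullet> x) / 2) *\<^sub>R (2 / (x \<bullet> x) * (LINT t|sphere_measure. (x \<bullet> t) ^ Suc n)) *\<^sub>R x"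
    by (rule arg_cong)
  then show ?thesis using False by simp
qed simp

lemma integral_sphere_measure_odd_vector_moment:
  fixes x :: "real ^ 'n"
  shows "(LINT t|sphere_measure. (x \<bullet> t) ^ (2 * j + 1) *\<^sub>R t)
    = ((x \<bullet> x) ^ j * (2 * Gamma (real j + 3 / 2) * sqrt pi ^ (CARD('n) - 1)
        / Gamma (real CARD('n) / 2 + real j + 1))) *\<^sub>R x"
proof (cases "x = 0")
  case False
  have "(x \<bullet> x) *\<^sub>R (LINT t|sphere_measure. (x \<bullet> t) ^ (2 * j + 1) *\<^sub>R t)
      = (LINT t|sphere_measure. (x \<bullet> t) ^ (2 * Suc j)) *\<^sub>R x"
    using integral_sphere_measure_vector_moment[of x "2 * j + 1"] by (simp only: Suc_eq_plus1 mult_Suc_right)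
      (simp add: add.commute)
  also have "(LINT t|sphere_measure. (x \<bullet> t) ^ (2 * Suc j))
      = (x \<bullet> x) * ((x \<bullet> x) ^ j * (2 * Gamma (real j + 3 / 2) * sqrt pi ^ (CARD('n) - 1)
        / Gamma (real CARD('n) / 2 + real j + 1)))"
  proof -
    have "real (Suc j) + 1 / 2 = real j + 3 / 2"
        "real CARD('n) / 2 + real (Suc j) = real CARD('n) / 2 + real j + 1"
      by simp_all
    moreover have "norm x ^ (2 * Suc j) = (x \<bullet> x) * (x \<bullet> x) ^ j"
      by (simp only: power_mult power2_norm_eq_inner power_Suc)
    ultimately show ?thesis
      by (simp only: integral_sphere_measure_inner_even_power mult.assoc)
  qed
  finally have "(x \<bullet> x) *\<^sub>R (LINT t|sphere_measure. (x \<bullet> t) ^ (2 * j + 1) *\<^sub>R t)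
      = (x \<bullet> x) *\<^sub>R ((x \<bullet> x) ^ j * (2 * Gamma (real j + 3 / 2) * sqrt pi ^ (CARD('n) - 1)
        / Gamma (real CARD('n) / 2 + real j + 1))) *\<^sub>R x"
    by (simp only: scaleR_scaleR)
  then show ?thesis using False by (simp only: scaleR_cancel_left inner_eq_zero_iff) simp
qed simp

section \<open>Odd powers of a Clifford vector\<close>

lemma cscalar_of_real_times: "cscalar (of_real r) * u = r *\<^sub>R (u :: 'n::{finite,linorder} clifford)"
  by (simp only: cscalar_of_real) (simp add: of_real_def)

lemma cscalar_sum: "cscalar (sum f A) = (\<Sum>a\<in>A. cscalar (f a))"
proof -
  have "cscalar 0 = (0 :: 'a clifford)"
    by (rule clifford_eqI) (simp add: ccoeffs_cscalar zero_clifford.rep_eq)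
  then show ?thesis
    by (induction A rule: infinite_finite_induct) (simp_all add: cscalar_add)
qed

lemma linear_vec_p: "linear (vec_p :: real ^ 'p \<Rightarrow> ('p + 'q::finite) clifford)"
  by (rule linearI) (simp_all add: vec_p_def scaleR_add_left sum.distrib scaleR_sum_right)

text \<open>
  Adding the double sum to itself with the two indices swapped leaves only anticommutators.
\<close>
lemma vec_p_times_self:
  fixes x :: "real ^ 'p::{finite,linorder}"
  shows "vec_p x * vec_p x = - of_real (x \<bullet> x) * (1 :: ('p + 'q::{finite,linorder}) clifford)"
proof -
  let ?e = "\<lambda>j. cgen (Inl j) :: ('p + 'q) clifford"
  have 1: "vec_p x * vec_p x = (\<Sum>i\<in>UNIV. \<Sum>j\<in>UNIV. (x $ i * x $ j) *\<^sub>R (?e i * ?e j))"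
    by (simp add: vec_p_def sum_product mult.commute)
  also have 2: "\<dots> = (\<Sum>i\<in>UNIV. \<Sum>j\<in>UNIV. (x $ i * x $ j) *\<^sub>R (?e j * ?e i))"
    by (rule trans[OF sum.swap]) (intro sum.cong refl, simp only: mult.commute)
  finally have "2 *\<^sub>R (vec_p x * vec_p x :: ('p + 'q) clifford)
      = (\<Sum>i\<in>UNIV. \<Sum>j\<in>UNIV. (x $ i * x $ j) *\<^sub>R (?e i * ?e j + ?e j * ?e i))"
    using 1 by (simp only: scaleR_2 sum.distrib scaleR_add_right)
  also have "\<dots> = (\<Sum>i\<in>UNIV. \<Sum>j\<in>UNIV. if j = i then (x $ i * x $ i) *\<^sub>R (-2) else 0)"
    by (intro sum.cong refl) (simp add: cgen_anticommute)
  also have "\<dots> = (\<Sum>i\<in>UNIV. (x $ i * x $ i) *\<^sub>R (-2))"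
    by (simp add: sum.delta)
  also have "\<dots> = (x \<bullet> x) *\<^sub>R (-2 :: ('p + 'q) clifford)"
    by (simp only: inner_vec_def inner_real_def scaleR_sum_left)
  also have "\<dots> = 2 *\<^sub>R (- of_real (x \<bullet> x) * 1)"
    by (simp add: scaleR_conv_of_real mult_2 mult_2_right)
  finally show ?thesis by (simp only: scaleR_cancel_left) simp
qed

lemma vec_p_odd_power:
  "vec_p x ^ (2 * j + 1) = ((-1) ^ j * (x \<bullet> x) ^ j) *\<^sub>R (vec_p x :: ('p::{finite,linorder} + 'q::{finite,linorder}) clifford)"
proof -
  have "vec_p x ^ (2 * j) = of_real ((- (x \<bullet> x)) ^ j) * (1 :: ('p + 'q) clifford)"
    by (simp only: power_mult power2_eq_square vec_p_times_self) simp
  moreover have "(- (x \<bullet> x)) ^ j = (-1) ^ j * (x \<bullet> x) ^ j"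
    by (rule power_minus)
  ultimately show ?thesis
    by (simp add: of_real_def)
qed

text \<open>
  The familiar form of the area; the cone measure supplies it as dimension times ball volume, and
  the functional equation of Gamma absorbs the dimension.
\<close>
lemma measure_sphere_Gamma:
  "measure sphere_measure (sphere (0 :: 'a::euclidean_space) 1)
    = 2 * sqrt pi ^ DIM('a) / Gamma (real DIM('a) / 2)"
proof -
  have "Gamma (real DIM('a) / 2) \<noteq> 0"
    by (intro less_imp_neq[symmetric] Gamma_real_pos) simp
  moreover have "Gamma (real DIM('a) / 2 + 1) = real DIM('a) / 2 * Gamma (real DIM('a) / 2)"
    by (rule Gamma_plus1) (auto dest!: nonpos_Ints_nonpos)
  moreover have "pi powr (real DIM('a) / 2) = sqrt pi ^ DIM('a)"
    by (simp add: powr_half_sqrt[symmetric] powr_powr powr_realpow[symmetric])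
  ultimately show ?thesis
    by (simp only: measure_sphere unit_ball_vol_def) (simp add: field_simps)
qed

section \<open>The integral formula\<close>

theorem proposition5p2:
  fixes x :: "real ^ 'p::{finite,linorder}"
    and y s :: "real ^ 'q::{finite,linorder}"
    and k :: nat
  assumes dim: "CARD('p) = CARD('r::finite) + 1"
    and s: "s \<in> sphere 0 1"
  shows "(LINT t|sphere_measure.
            cscalar ((of_real (x \<bullet> t) + \<i> * of_real (y \<bullet> s)) ^ k)
              * (vec_p t :: ('p + 'q) clifford))
    = cscalar (of_real (measure sphere_measure (sphere (0 :: real ^ 'r) 1)))
      * (\<Sum>j\<in>{j :: nat. int j \<le> \<lfloor>(real k - 1) / 2\<rfloor>}.
          vec_p x ^ (2 * j + 1)
          * cscalar ((-1) ^ j * of_nat (k choose (2 * j + 1))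
              * of_real (Gamma ((real CARD('p) - 1) / 2) * Gamma (real j + 3 / 2)
                          / Gamma (real CARD('p) / 2 + real j + 1))
              * (\<i> * of_real (y \<bullet> s)) ^ (k - 2 * j - 1)))"
proof -
  define w where "w = \<i> * complex_of_real (y \<bullet> s)"
  define c where "c n = of_nat (k choose n) * w ^ (k - n)" for n
  define V where "V n = (LINT t|sphere_measure. (x \<bullet> t) ^ n *\<^sub>R t)" for n
  define L where "L = measure sphere_measure (sphere (0 :: real ^ 'r) 1)"
  define G where "G j = Gamma (real j + 3 / 2) / Gamma (real CARD('p) / 2 + real j + 1)" for j
  let ?v = "vec_p :: (real, 'p) vec \<Rightarrow> ('p + 'q) clifford"
  have bl: "bounded_linear (\<lambda>t. cscalar z * ?v t)" for z
    unfolding linear_conv_bounded_linear[symmetric]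
    using linear_vec_p[where 'p = 'p and 'q = 'q]
    by (auto simp: linear_iff ring_distribs)
  have expand: "cscalar ((of_real (x \<bullet> t) + w) ^ k) * ?v t
      = (\<Sum>n\<le>k. cscalar (c n) * ?v ((x \<bullet> t) ^ n *\<^sub>R t))" for t
  proof -
    have "(of_real (x \<bullet> t) + w) ^ k = (\<Sum>n\<le>k. c n * of_real ((x \<bullet> t) ^ n))"
      unfolding binomial_ring by (intro sum.cong) (simp_all add: c_def)
    then show ?thesis
      by (simp only: cscalar_sum sum_distrib_right cscalar_mult mult.assoc cscalar_of_real_times
          linear_cmul[OF linear_vec_p])
  qed
  have int: "integrable sphere_measure (\<lambda>t. (x \<bullet> t) ^ n *\<^sub>R t)" for n
    by (intro integrable_sphere_measure continuous_intros)
  have "(LINT t|sphere_measure. cscalar ((of_real (x \<bullet> t) + w) ^ k) * ?v t)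
      = (\<Sum>n\<le>k. LINT t|sphere_measure. cscalar (c n) * ?v ((x \<bullet> t) ^ n *\<^sub>R t))"
    unfolding expand
    by (intro Bochner_Integration.integral_sum integrable_bounded_linear[OF bl int])
  also have "\<dots> = (\<Sum>n\<le>k. cscalar (c n) * ?v (V n))"
    unfolding V_def by (intro sum.cong refl integral_bounded_linear[OF bl int])
  also have "\<dots> = (\<Sum>n\<in>(\<lambda>j. 2 * j + 1) ` {j. 2 * j + 1 \<le> k}. cscalar (c n) * ?v (V n))"
  proof (rule sum.mono_neutral_right)
    have "even n" if "n \<le> k" "n \<notin> (\<lambda>j. 2 * j + 1) ` {j. 2 * j + 1 \<le> k}" for n
    proof (rule ccontr)
      assume "odd n"
      then obtain j where "n = 2 * j + 1" by (rule oddE)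
      with that show False by auto
    qed
    then show "\<forall>n\<in>{..k} - (\<lambda>j. 2 * j + 1) ` {j. 2 * j + 1 \<le> k}. cscalar (c n) * ?v (V n) = 0"
      by (auto simp: V_def integral_sphere_measure_even_vector_moment linear_0[OF linear_vec_p])
  qed auto
  also have "\<dots> = (\<Sum>j\<in>{j. 2 * j + 1 \<le> k}. cscalar (c (2 * j + 1)) * ?v (V (2 * j + 1)))"
    by (subst sum.reindex) (auto simp: inj_on_def)
  also have "\<dots> = (\<Sum>j\<in>{j. 2 * j + 1 \<le> k}. cscalar (of_real L) * (?v x ^ (2 * j + 1)
      * cscalar ((-1) ^ j * of_nat (k choose (2 * j + 1))
          * of_real (Gamma ((real CARD('p) - 1) / 2) * Gamma (real j + 3 / 2)
                      / Gamma (real CARD('p) / 2 + real j + 1))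
          * w ^ (k - 2 * j - 1))))"
  proof (rule sum.cong[OF refl])
    fix j
    \<comment> \<open>The area of the sphere one dimension lower enters only to supply the power of \<open>sqrt pi\<close>;
      the factor \<open>\<Gamma>((p - 1)/2)\<close> of the coefficient cancels its denominator.\<close>
    have LG: "L * Gamma ((real CARD('p) - 1) / 2) = 2 * sqrt pi ^ (CARD('p) - 1)"
    proof -
      have "Gamma (real CARD('r) / 2) \<noteq> 0"
        by (intro less_imp_neq[symmetric] Gamma_real_pos) simp
      then show ?thesis by (simp add: L_def measure_sphere_Gamma dim)
    qed
    have V: "V (2 * j + 1) = ((x \<bullet> x) ^ j * (2 * sqrt pi ^ (CARD('p) - 1) * G j)) *\<^sub>R x"
      unfolding V_def integral_sphere_measure_odd_vector_moment by (simp add: G_def mult_ac)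
    have "cscalar (c (2 * j + 1)) * ?v (V (2 * j + 1))
        = cscalar (c (2 * j + 1) * of_real ((x \<bullet> x) ^ j * (2 * sqrt pi ^ (CARD('p) - 1) * G j))) * ?v x"
      by (simp only: V linear_cmul[OF linear_vec_p] cscalar_mult[of "c (2 * j + 1)"]
          cscalar_of_real_times mult.assoc)
    also have "c (2 * j + 1) * of_real ((x \<bullet> x) ^ j * (2 * sqrt pi ^ (CARD('p) - 1) * G j))
       = of_real L * of_real ((-1) ^ j * (x \<bullet> x) ^ j)
          * ((-1) ^ j * of_nat (k choose (2 * j + 1))
          * of_real (Gamma ((real CARD('p) - 1) / 2) * Gamma (real j + 3 / 2)
                      / Gamma (real CARD('p) / 2 + real j + 1))
          * w ^ (k - 2 * j - 1))"
    proof -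
      \<comment> \<open>One sign is that of the coefficient, the other that of the odd Clifford power.\<close>
      have sgn: "(-1) ^ j * (-1) ^ j = (1 :: complex)"
        by (simp flip: power_mult_distrib)
      have "L * (Gamma ((real CARD('p) - 1) / 2) * Gamma (real j + 3 / 2)
          / Gamma (real CARD('p) / 2 + real j + 1)) = 2 * sqrt pi ^ (CARD('p) - 1) * G j"
        by (simp only: G_def times_divide_eq_right mult.assoc[symmetric] LG)
      then have prod: "of_real L * of_real (Gamma ((real CARD('p) - 1) / 2) * Gamma (real j + 3 / 2)
          / Gamma (real CARD('p) / 2 + real j + 1))
          = (of_real (2 * sqrt pi ^ (CARD('p) - 1) * G j) :: complex)"
        by (simp only: of_real_mult[symmetric])
      have regroup: "l * (e * X) * (e * N * g * W) = (e * e) * (N * W * (X * (l * g)))"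
        for l e X N g W :: complex
        by (simp add: mult_ac)
      have deg: "k - 2 * j - 1 = k - (2 * j + 1)" by simp
      have "of_real L * of_real ((-1) ^ j * (x \<bullet> x) ^ j)
          * ((-1) ^ j * of_nat (k choose (2 * j + 1))
          * of_real (Gamma ((real CARD('p) - 1) / 2) * Gamma (real j + 3 / 2)
                      / Gamma (real CARD('p) / 2 + real j + 1))
          * w ^ (k - 2 * j - 1))
        = ((-1) ^ j * (-1) ^ j) * (c (2 * j + 1)
            * of_real ((x \<bullet> x) ^ j * (2 * sqrt pi ^ (CARD('p) - 1) * G j)))"
        unfolding c_def of_real_mult[of "(x \<bullet> x) ^ j"] of_real_mult[of "(-1) ^ j"] deg prod[symmetric]
        by (simp only: of_real_power of_real_minus of_real_1 regroup)
      then show ?thesis by (simp only: sgn mult_1)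
    qed
    also have "cscalar \<dots> * ?v x = cscalar (of_real L) * (?v x ^ (2 * j + 1)
      * cscalar ((-1) ^ j * of_nat (k choose (2 * j + 1))
          * of_real (Gamma ((real CARD('p) - 1) / 2) * Gamma (real j + 3 / 2)
                      / Gamma (real CARD('p) / 2 + real j + 1))
          * w ^ (k - 2 * j - 1)))"
    proof -
      have regroup: "cscalar (l * r * z) * v = cscalar l * ((cscalar r * v) * cscalar z)"
        for l r z and v :: "('p + 'q) clifford"
        by (simp only: cscalar_mult mult.assoc cscalar_central[of z v])
      show ?thesis
        unfolding vec_p_odd_power cscalar_of_real_times[symmetric] by (rule regroup)
    qed
    finally show "cscalar (c (2 * j + 1)) * ?v (V (2 * j + 1)) = cscalar (of_real L) * (?v x ^ (2 * j + 1)
      * cscalar ((-1) ^ j * of_nat (k choose (2 * j + 1))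
          * of_real (Gamma ((real CARD('p) - 1) / 2) * Gamma (real j + 3 / 2)
                      / Gamma (real CARD('p) / 2 + real j + 1))
          * w ^ (k - 2 * j - 1)))" .
  qed
  also have "{j. 2 * j + 1 \<le> k} = {j :: nat. int j \<le> \<lfloor>(real k - 1) / 2\<rfloor>}"
    by (auto simp: le_floor_iff)
  finally show ?thesis
    by (simp only: w_def L_def sum_distrib_left)
qed

end
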